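(* Let $\varepsilon>0$ and let $T:\mathbb N\to\mathbb N$ (with $T=T(n)\ge 1$) satisfy $T(n)=O\left(2^{\frac{n}{7+\varepsilon}}\right)$. Let a black box (length preserving function) $f:\{0,1\}^*\to\{0,1\}^*$ be chosen randomly according to the uniform probability measure $P$ on oracles. Then with probability 1 every quantum computation of $T$ iterations of $f$ requires $T$ evaluations of $f$. That is, for $P$-almost every $f$ there is no quantum query machine $C$ that, with oracle for $f$, computes for every $n$ and every $x\in\{0,1\}^n$ the word $f^{\{T(n)\}}(x)$ (with probability at least $2/3$) using no more than $T(n)-1$ evaluations of $f$ on inputs of length $n$.
   Context: Iterations: for a length preserving function $f:\{0,1\}^*\to\{0,1\}^*$ (so $|f(x)|=|x|$) put $f^{\{0\}}(x)=x$, $f^{\{k+1\}}(x)=f(f^{\{k\}}(x))$. Uniform measure on oracles: let $M_n$ be the set of all maps $\{0,1\}^n\to\{0,1\}^n$, $v_n=|M_n|=2^{n2^n}$. A length preserving function $f$ (an oracle, or black box) is identified with the sequence $(g_1,g_2,\ldots)$, $g_i\in M_i$, of its restrictions. For fixed $g_i\in M_i$, $i\le n$, let $A(g_1,\ldots,g_n)$ be the set of oracles whose first $n$ restrictions are $g_1,\ldots,g_n$, and put $P(A(g_1,\ldots,g_n))=(v_1v_2\cdots v_n)^{-1}$. $P$ is the extension of this to a probability measure on the $\sigma$-algebra generated by all such sets (equivalently, the restrictions $g_n$ are independent and uniform on $M_n$). Quantum query machine: fix once and for all a finite set $\mathcal U$ of unitary transformations, each acting on a Hilbert space of dimension $2^m$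 for some $m$. A machine $C$ with time complexity $\tau=\tau(n)$ on inputs of length $n$ has a quantum part and a classical part. Quantum part: qubits $v_1,\ldots,v_\tau$ (working tape) and $v_{\tau+1},\ldots,v_{\tau+2n}$ (query tape). Its pure states are the unit vectors of $\mathcal H=\mathcal H_1\otimes\cdots\otimes\mathcal H_{\tau+2n}$, $\mathcal H_i=\mathbb C^2$, of dimension $K=2^{\tau+2n}$, with orthonormal basis $e_0,\ldots,e_{K-1}$ of basic states $|s_1,\ldots,s_{\tau+2n}\rangle$, $s_j\in\{0,1\}$. For $G\subset\{1,\ldots,\tau+2n\}$ and $U\in\mathcal U$ acting on a $2^{|G|}$-dimensional space, the working transform $W_{G,U}$ acts as $U$ on $\bigotimes_{i\in G}\mathcal H_i$ and as the identity on the other factors. The query transform $\mathrm{Qu}_f$ acts as $F_n|\bar a,\bar b\rangle=|\bar a,f(\bar a)\oplus\bar b\rangle$ ($\bar a,\bar b\in\{0,1\}^n$, $\oplus$ bitwise addition modulo 2) on $\bigotimes_{i=\tau+1}^{\tau+2n}\mathcal H_i$ and as the identity on $\bigotimes_{i=1}^{\tau}\mathcal H_i$. Observing the state $\sum_i\lambda_ie_i$ yields $e_i$ with probability $|\lambda_i|^2$. Classical part: a classical (deterministic) Turing machine with a few heads, working on two tapes (working and query) over a finite alphabet $\omega$, whose cells correspond one-to-one to the qubits. The integrated state of the heads in a classical state $D$ is denoted $h(D)$; the set of such states contains special elements $q_b,q_w,q_q,q_o$. A rule of correspondence $R$ assigns to every classical state $D$ a pair $R(D)=\langle G,U\rangle$,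 where $G$ is the set of numbers of the cells containing a special letter $a_0\in\omega$, and $U\in\mathcal U$ acts on a $2^{|G|}$-dimensional space and depends only on $h(D)$. Computation: a chain $S_0\to S_1\to\cdots\to S_\tau$ of pairs $S_i=\langle Q(S_i),D_i\rangle$ (quantum state, classical state), where $D_i\to D_{i+1}$ is a step of the Turing machine, $D_0$ is the initial classical state corresponding to the input word $a\in\{0,1\}^n$ with $h(D_0)=q_b$, $Q(S_0)=e_0$; if $h(D_i)=q_w$ then $Q(S_{i+1})=W_{R(D_i)}(Q(S_i))$; if $h(D_i)=q_q$ then $Q(S_{i+1})=\mathrm{Qu}_f(Q(S_i))$; in all other cases $Q(S_{i+1})=Q(S_i)$; $h(D_i)=q_b$ only for $i=0$ and $h(D_i)=q_o$ only for $i=\tau$. The number of evaluations of $f$ is the number of $i$ for which the query transform is applied. The machine computes a function $F$ if for every input $a$ the observation of $S_\tau$ followed by a routine classical procedure fixed beforehand gives $F(a)$ with probability at least $2/3$. The machines (including the final routine procedure) are finitely described, so there are countably many of them, $C_1,C_2,\ldots$. *)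

theory Defs
  imports
    "HOL-Probability.Probability"
    "HOL-Library.Finite_Map"
    "HOL-Library.Landau_Symbols"
    "Jordan_Normal_Form.Schur_Decomposition"
begin

unbundle no vec_syntax

definition words :: "nat \<Rightarrow> bool list set" where
  "words n = {x. length x = n}"

definition maps :: "nat \<Rightarrow> (bool list \<Rightarrow> bool list) set" where
  "maps n = words n \<rightarrow>\<^sub>E words n"

definition oracles :: "(bool list \<Rightarrow> bool list) set" where
  "oracles = {f. \<forall>x. length (f x) = length x}"

definition cylinder :: "nat \<Rightarrow> (nat \<Rightarrow> bool list \<Rightarrow> bool list) \<Rightarrow> (bool list \<Rightarrow> bool list) set" where
  "cylinder n g = {f \<in> oracles. \<forall>i\<in>{1..n}. restrict f (words i) = g i}"

definition cylinders :: "(bool list \<Rightarrow> bool list) set set" where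
  "cylinders = {cylinder n g | n g. \<forall>i\<in>{1..n}. g i \<in> maps i}"

text \<open>The sequence of restrictions starts at length 1; the empty word is necessarily mapped to
  itself.\<close>

definition oracle_of :: "(nat \<Rightarrow> bool list \<Rightarrow> bool list) \<Rightarrow> bool list \<Rightarrow> bool list" where
  "oracle_of g x = (if x = [] then [] else g (length x) x)"

definition oracle_measure :: "(bool list \<Rightarrow> bool list) measure" where
  "oracle_measure =
     distr (PiM {1..} (\<lambda>n. uniform_count_measure (maps n))) (sigma oracles cylinders) oracle_of"

lemma finite_words [simp]: "finite (words n)"
  and card_words: "card (words n) = 2 ^ n"
  using finite_lists_length_eq[of "UNIV :: bool set" n] card_lists_length_eq[of "UNIV :: bool set" n]
  by (simp_all add: words_def)

lemma finite_maps [simp]: "finite (maps n)"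
  by (simp add: maps_def finite_PiE)

lemma card_maps: "card (maps n) = 2 ^ (n * 2 ^ n)"
  by (simp add: maps_def card_PiE card_words power_mult)

lemma maps_nonempty: "maps n \<noteq> {}"
  using card_maps[of n] by (metis card.empty power_not_zero zero_neq_numeral)

lemma prob_space_maps: "prob_space (uniform_count_measure (maps n))"
  by (rule prob_space_uniform_count_measure) (simp_all add: maps_nonempty)

lemma oracle_of_in_oracles:
  assumes "\<And>i. i \<ge> 1 \<Longrightarrow> g i \<in> maps i"
  shows "oracle_of g \<in> oracles"
proof -
  have "length (oracle_of g x) = length x" for x
    using assms[of "length x"]
    by (cases x) (auto simp: oracle_of_def maps_def words_def PiE_def Pi_def)
  then show ?thesis by (simp add: oracles_def)
qed

lemma restrict_oracle_of:
  assumes "\<And>i. i \<ge> 1 \<Longrightarrow> g i \<in> maps i" "i \<ge> 1"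
  shows "restrict (oracle_of g) (words i) = g i"
proof
  fix x
  show "restrict (oracle_of g) (words i) x = g i x"
  proof (cases "x \<in> words i")
    case True
    then show ?thesis using assms(2) by (auto simp: oracle_of_def words_def)
  next
    case False
    then show ?thesis using assms by (auto simp: maps_def PiE_def extensional_def)
  qed
qed

lemma vimage_cylinder:
  assumes "\<forall>i\<in>{1..n}. g i \<in> maps i"
  shows "oracle_of -` cylinder n g \<inter> space (PiM {1..} (\<lambda>n. uniform_count_measure (maps n))) =
    prod_emb {1..} (\<lambda>n. uniform_count_measure (maps n)) {1..n} (PiE {1..n} (\<lambda>i. {g i}))"
    (is "?L = ?R")
proof -
  have "h \<in> ?L \<longleftrightarrow> h \<in> ?R" for h
  proof (cases "h \<in> PiE {1..} maps")
    case True
    then have h: "\<And>i. i \<ge> 1 \<Longrightarrow> h i \<in> maps i" by auto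
    have "h \<in> ?L \<longleftrightarrow> (\<forall>i\<in>{1..n}. h i = g i)"
      using True oracle_of_in_oracles[OF h] restrict_oracle_of[OF h]
      by (auto simp: cylinder_def space_PiM space_uniform_count_measure)
    also have "\<dots> \<longleftrightarrow> h \<in> ?R"
      using True
      by (auto simp: prod_emb_def space_uniform_count_measure restrict_PiE_iff)
    finally show ?thesis .
  next
    case False
    then show ?thesis
      by (auto simp: prod_emb_def space_PiM space_uniform_count_measure)
  qed
  then show ?thesis by blast
qed

lemma space_oracle_measure: "space oracle_measure = oracles"
  and sets_oracle_measure: "sets oracle_measure = sigma_sets oracles cylinders"
  by (auto simp: oracle_measure_def cylinders_def cylinder_def space_measure_of_conv
      intro!: sets_measure_of)

lemma measurable_oracle_of:
  "oracle_of \<in> measurable (PiM {1..} (\<lambda>n. uniform_count_measure (maps n))) (sigma oracles cylinders)"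
proof (rule measurable_measure_of)
  show "cylinders \<subseteq> Pow oracles" by (auto simp: cylinders_def cylinder_def)
  show "oracle_of \<in> space (PiM {1..} (\<lambda>n. uniform_count_measure (maps n))) \<rightarrow> oracles"
    by (auto simp: space_PiM space_uniform_count_measure intro!: oracle_of_in_oracles)
  fix A assume "A \<in> cylinders"
  then obtain n g where A: "A = cylinder n g" and g: "\<forall>i\<in>{1..n}. g i \<in> maps i"
    by (auto simp: cylinders_def)
  show "oracle_of -` A \<inter> space (PiM {1..} (\<lambda>n. uniform_count_measure (maps n)))
      \<in> sets (PiM {1..} (\<lambda>n. uniform_count_measure (maps n)))"
    unfolding A vimage_cylinder[OF g]
    by (rule sets_PiM_I) (use g in \<open>auto simp: sets_uniform_count_measure\<close>)
qed

lemma prob_space_oracle_measure: "prob_space oracle_measure"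
  unfolding oracle_measure_def
  by (intro prob_space.prob_space_distr prob_space_PiM prob_space_maps measurable_oracle_of)

lemma emeasure_cylinder:
  assumes g: "\<forall>i\<in>{1..n}. g i \<in> maps i"
  shows "emeasure oracle_measure (cylinder n g) = ennreal (1 / (\<Prod>i=1..n. real (card (maps i))))"
proof -
  have "cylinder n g \<in> sets (sigma oracles cylinders)"
    using g by (subst sets_measure_of) (auto simp: cylinders_def cylinder_def)
  then have "emeasure oracle_measure (cylinder n g) =
      emeasure (PiM {1..} (\<lambda>n. uniform_count_measure (maps n)))
        (prod_emb {1..} (\<lambda>n. uniform_count_measure (maps n)) {1..n} (PiE {1..n} (\<lambda>i. {g i})))"
    unfolding oracle_measure_def
    by (simp only: emeasure_distr[OF measurable_oracle_of] vimage_cylinder[OF g])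
  also have "\<dots> = (\<Prod>i\<in>{1..n}. emeasure (uniform_count_measure (maps i)) {g i})"
    using g by (intro emeasure_PiM_emb prob_space_maps) (auto simp: sets_uniform_count_measure)
  also have "\<dots> = (\<Prod>i\<in>{1..n}. ennreal (1 / real (card (maps i))))"
    using g by (intro prod.cong refl) (simp add: emeasure_uniform_count_measure)
  also have "\<dots> = ennreal (1 / (\<Prod>i=1..n. real (card (maps i))))"
    by (simp add: prod_ennreal prod_dividef)
  finally show ?thesis .
qed

datatype tape = Work | Query

datatype move = Move_Left | Stay | Move_Right

text \<open>\<open>Marked\<close> is the special letter \<open>a\<^sub>0\<close> selecting the cells whose qubits are to be
  transformed. The letter \<open>Observed c b\<close> only serves to present the outcome of the final observation
  to the readout procedure (see \<open>readout_start\<close>).\<close>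

datatype letter = Blank | Bit bool | Marked | Aux nat | Observed letter bool

text \<open>The integrated state of all heads.\<close>

datatype head_state = q_b | q_w | q_q | q_o | q_aux nat

text \<open>A program is a finite table, so only finitely many letters and head states are relevant
  to any machine and a machine is a finite object. \<open>heads\<close> lists, for each head, the tape it works on;
  an entry of \<open>table\<close> sends the head state and the scanned letters to the new head state and, for each
  head, the letter it writes and its movement.\<close>

record tm =
  heads :: "tape list"
  "table" :: "(head_state \<times> letter list, head_state \<times> (letter \<times> move) list) fmap"

definition wf_tm :: "tm \<Rightarrow> bool" where
  "wf_tm M \<longleftrightarrow> (\<forall>(q, acts) \<in> fmran' (table M). length acts = length (heads M))"

record config =
  control :: head_state
  contents :: "tape \<Rightarrow> nat \<Rightarrow> letter"
  positions :: "nat list"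

text \<open>Cells are numbered from 0. The query tape has exactly \<open>2 * n\<close> cells and heads cannot leave it.
  The working tape is unbounded to the right, so that a machine cannot read off its own running time
  from the tape; in \<open>\<tau>\<close> steps only its first \<open>\<tau>\<close> cells are scanned, and these are the cells having
  qubits.\<close>

definition move_head :: "nat \<Rightarrow> tape \<Rightarrow> move \<Rightarrow> nat \<Rightarrow> nat" where
  "move_head n t m p =
     (case m of
        Move_Left \<Rightarrow> p - 1
      | Stay \<Rightarrow> p
      | Move_Right \<Rightarrow> (case t of Work \<Rightarrow> p + 1 | Query \<Rightarrow> min (p + 1) (2 * n - 1)))"

text \<open>If several heads scan the same cell, the last of them in the list determines what is written.
  Without an applicable table entry the machine is stuck for ever.\<close>

definition step :: "nat \<Rightarrow> tm \<Rightarrow> config \<Rightarrow> config" where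
  "step n M D =
     (case fmlookup (table M) (control D, map2 (contents D) (heads M) (positions D)) of
        None \<Rightarrow> D
      | Some (q, acts) \<Rightarrow>
          \<lparr> control = q,
            contents = fold (\<lambda>((t, p), (w, m)) c. c(t := (c t)(p := w)))
                         (zip (zip (heads M) (positions D)) acts) (contents D),
            positions = map (\<lambda>((t, p), (w, m)). move_head n t m p)
                          (zip (zip (heads M) (positions D)) acts) \<rparr>)"

text \<open>The input word is written on the first \<open>n\<close> of the \<open>2 * n\<close> cells of the query tape.\<close>

definition start :: "tm \<Rightarrow> bool list \<Rightarrow> config" where
  "start M a =
     \<lparr> control = q_b,
       contents = (\<lambda>t i. if t = Query \<and> i < length a then Bit (a ! i) else Blank),
       positions = replicate (length (heads M)) 0 \<rparr>"

text \<open>The qubits of the working tape have numbers \<open>0, \<dots>, \<tau> - 1\<close>, those of the query tape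
  \<open>\<tau>, \<dots>, \<tau> + 2 * n - 1\<close>. The basic state with index \<open>i\<close> of \<open>N\<close> qubits is \<open>bits N i\<close>, the list of
  the binary digits of \<open>i\<close>, least significant first; conversely \<open>index s\<close> is the index of \<open>s\<close>.\<close>

definition bits :: "nat \<Rightarrow> nat \<Rightarrow> bool list" where
  "bits N i = map (bit i) [0..<N]"

definition index :: "bool list \<Rightarrow> nat" where
  "index s = horner_sum of_bool 2 s"

lemma index_bits: "i < 2 ^ N \<Longrightarrow> index (bits N i) = i"
  by (simp add: index_def bits_def horner_sum_bit_eq_take_bit take_bit_nat_eq_self)

lemma bits_index: "length s = N \<Longrightarrow> bits N (index s) = s"
  by (rule nth_equalityI) (auto simp: index_def bits_def bit_horner_sum_bit_iff)

definition unitary_mat :: "complex mat \<Rightarrow> bool" where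
  "unitary_mat U \<longleftrightarrow> square_mat U \<and> mat_adjoint U * U = 1\<^sub>m (dim_row U)"

text \<open>\<open>U\<close> on the qubits in \<open>G\<close> (in increasing order), tensored with the identity on the others.\<close>

definition working_transform :: "nat \<Rightarrow> nat set \<Rightarrow> complex mat \<Rightarrow> complex mat" where
  "working_transform N G U =
     Matrix.mat (2 ^ N) (2 ^ N) (\<lambda>(i, j).
       if nths (bits N i) (- G) = nths (bits N j) (- G)
       then U $$ (index (nths (bits N i) G), index (nths (bits N j) G)) else 0)"

definition query_basis :: "(bool list \<Rightarrow> bool list) \<Rightarrow> nat \<Rightarrow> nat \<Rightarrow> bool list \<Rightarrow> bool list" where
  "query_basis f t n s =
     (let w = take t s; a = take n (drop t s); b = drop (t + n) s
      in w @ a @ map2 (\<noteq>) (f a) b)"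

definition query_transform :: "(bool list \<Rightarrow> bool list) \<Rightarrow> nat \<Rightarrow> nat \<Rightarrow> complex mat" where
  "query_transform f t n =
     Matrix.mat (2 ^ (t + 2 * n)) (2 ^ (t + 2 * n)) (\<lambda>(i, j).
       if bits (t + 2 * n) i = query_basis f t n (bits (t + 2 * n) j) then 1 else 0)"

text \<open>\<open>gate\<close> is the dependence of the unitary in the rule of correspondence on the head state;
  \<open>readout\<close> is the classical procedure applied to the observed final state.\<close>

record machine =
  classical :: tm
  gate :: "head_state \<Rightarrow> complex mat"
  readout :: tm

definition classical_state :: "machine \<Rightarrow> bool list \<Rightarrow> nat \<Rightarrow> config" where
  "classical_state C a i = (step (length a) (classical C) ^^ i) (start (classical C) a)"

definition marked_cells :: "nat \<Rightarrow> nat \<Rightarrow> config \<Rightarrow> nat set" where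
  "marked_cells t n D =
     {i. i < t \<and> contents D Work i = Marked} \<union>
     {t + i | i. i < 2 * n \<and> contents D Query i = Marked}"

text \<open>\<open>C\<close> is a machine over the gate set \<open>\<U>\<close> with time complexity \<open>\<tau>\<close>. A machine that gets stuck
  never reaches \<^const>\<open>q_o\<close> and is therefore excluded; \<open>\<tau>\<close> is determined by \<open>C\<close>.\<close>

definition query_machine :: "complex mat set \<Rightarrow> machine \<Rightarrow> (nat \<Rightarrow> nat) \<Rightarrow> bool" where
  "query_machine \<U> C \<tau> \<longleftrightarrow>
     wf_tm (classical C) \<and> wf_tm (readout C) \<and> (\<forall>q. gate C q \<in> \<U>) \<and>
     (\<forall>a. \<forall>i \<le> \<tau> (length a).
        let D = classical_state C a i; d = 2 ^ card (marked_cells (\<tau> (length a)) (length a) D)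
        in (control D = q_b \<longleftrightarrow> i = 0) \<and>
           (control D = q_o \<longleftrightarrow> i = \<tau> (length a)) \<and>
           (control D = q_w \<longrightarrow> gate C (control D) \<in> carrier_mat d d))"

primrec quantum_state ::
    "(bool list \<Rightarrow> bool list) \<Rightarrow> machine \<Rightarrow> (nat \<Rightarrow> nat) \<Rightarrow> bool list \<Rightarrow> nat \<Rightarrow> complex Matrix.vec" where
  "quantum_state f C \<tau> a 0 = unit_vec (2 ^ (\<tau> (length a) + 2 * length a)) 0"
| "quantum_state f C \<tau> a (Suc i) =
     (let n = length a; t = \<tau> n; D = classical_state C a i; \<psi> = quantum_state f C \<tau> a i
      in if control D = q_w
           then working_transform (t + 2 * n) (marked_cells t n D) (gate C (control D)) *\<^sub>v \<psi>
         else if control D = q_q then query_transform f t n *\<^sub>v \<psi>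
         else \<psi>)"

definition evaluations :: "machine \<Rightarrow> (nat \<Rightarrow> nat) \<Rightarrow> bool list \<Rightarrow> nat" where
  "evaluations C \<tau> a = card {i. i < \<tau> (length a) \<and> control (classical_state C a i) = q_q}"

text \<open>The readout procedure starts from the tapes of the final classical state \<open>D\<close>, where each cell
  having a qubit additionally shows the observed value of this qubit. Its output is the word
  found at the beginning of the working tape, followed by a blank, when it first reaches
  \<^const>\<open>q_o\<close>.\<close>

definition readout_start :: "tm \<Rightarrow> nat \<Rightarrow> nat \<Rightarrow> config \<Rightarrow> bool list \<Rightarrow> config" where
  "readout_start M t n D s =
     \<lparr> control = q_b,
       contents = (\<lambda>tp i.
         case tp of
           Work \<Rightarrow> if i < t then Observed (contents D Work i) (s ! i) else contents D Work i
         | Query \<Rightarrow> if i < 2 * n then Observed (contents D Query i) (s ! (t + i))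
                    else contents D Query i),
       positions = replicate (length (heads M)) 0 \<rparr>"

definition halts_with :: "nat \<Rightarrow> tm \<Rightarrow> config \<Rightarrow> bool list \<Rightarrow> bool" where
  "halts_with n M D w \<longleftrightarrow>
     (\<exists>k. control ((step n M ^^ k) D) = q_o \<and> (\<forall>j<k. control ((step n M ^^ j) D) \<noteq> q_o) \<and>
          (\<forall>i<length w. contents ((step n M ^^ k) D) Work i = Bit (w ! i)) \<and>
          contents ((step n M ^^ k) D) Work (length w) = Blank)"

definition output_prob ::
    "(bool list \<Rightarrow> bool list) \<Rightarrow> machine \<Rightarrow> (nat \<Rightarrow> nat) \<Rightarrow> bool list \<Rightarrow> bool list \<Rightarrow> real" where
  "output_prob f C \<tau> a w =
     (let n = length a; t = \<tau> n; D = classical_state C a t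
      in \<Sum>i | i < 2 ^ (t + 2 * n) \<and>
              halts_with n (readout C) (readout_start (readout C) t n D (bits (t + 2 * n) i)) w.
           (cmod (Matrix.vec_index (quantum_state f C \<tau> a t) i))\<^sup>2)"

definition computes ::
    "(bool list \<Rightarrow> bool list) \<Rightarrow> machine \<Rightarrow> (nat \<Rightarrow> nat) \<Rightarrow> (bool list \<Rightarrow> bool list) \<Rightarrow> bool" where
  "computes f C \<tau> F \<longleftrightarrow> (\<forall>a. output_prob f C \<tau> a (F a) \<ge> 2 / 3)"

end

theory Submission
  imports Defs
begin

text \<open>
  Fix an input \<open>a\<close> of length \<open>n\<close>. Draw a uniform map \<open>f\<close> and uniform words
  \<open>y\<^sub>0, \<dots>, y\<^sub>T\<^sub>-\<^sub>1\<close>, and reprogram \<open>f\<close> along the chain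
  \<open>a \<mapsto> y\<^sub>0 \<mapsto> y\<^sub>1 \<mapsto> \<dots> \<mapsto> y\<^sub>T\<^sub>-\<^sub>1\<close>. As long as the chain does not run into itself, the
  reprogrammed map is again uniformly distributed and \<open>y\<^sub>T\<^sub>-\<^sub>1\<close> is its \<open>T\<close>-th iterate at \<open>a\<close>.
  Compare the run of a machine on this map with a hybrid run whose \<open>k\<close>-th query is answered
  by the map reprogrammed at the first \<open>k\<close> links only. The two answers differ only at
  \<open>y\<^sub>k\<^sub>-\<^sub>1, \<dots>, y\<^sub>T\<^sub>-\<^sub>2\<close>, which are independent of the hybrid state at that moment, so the
  expected squared amplitude on these queries is at most \<open>T / 2\<^sup>n\<close>. After at most \<open>T - 1\<close> queries
  the hybrid state is independent of \<open>y\<^sub>T\<^sub>-\<^sub>1\<close> and yields it with probability at most \<open>2\<^sup>-\<^sup>n\<close>.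
  Hence a random map is computed successfully at \<open>a\<close> with probability \<open>O(T\<^sup>3 / 2\<^sup>n)\<close>, which tends
  to \<open>0\<close>, and there are essentially countably many machines.
\<close>

subsection \<open>Isometry of the transforms\<close>

definition nrm :: "complex Matrix.vec \<Rightarrow> real" where
  "nrm v = L2_set (\<lambda>i. cmod (Matrix.vec_index v i)) {..<dim_vec v}"

lemma nrm_nonneg [simp]: "nrm v \<ge> 0"
  by (simp add: nrm_def L2_set_nonneg)

lemma nrm_power2: "(nrm v)\<^sup>2 = (\<Sum>i<dim_vec v. (cmod (Matrix.vec_index v i))\<^sup>2)"
  by (simp add: nrm_def L2_set_def sum_nonneg)

lemma nrm_triangle:
  assumes "v \<in> carrier_vec K" "w \<in> carrier_vec K"
  shows "nrm (v + w) \<le> nrm v + nrm w"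
proof -
  have "nrm (v + w) \<le> L2_set (\<lambda>i. cmod (Matrix.vec_index v i) + cmod (Matrix.vec_index w i)) {..<K}"
    unfolding nrm_def using assms
    by (auto intro!: L2_set_mono simp: norm_triangle_ineq)
  also have "\<dots> \<le> L2_set (\<lambda>i. cmod (Matrix.vec_index v i)) {..<K} +
      L2_set (\<lambda>i. cmod (Matrix.vec_index w i)) {..<K}"
    by (rule L2_set_triangle_ineq)
  finally show ?thesis using assms by (simp add: nrm_def)
qed

lemma nrm_unit_vec: "i < K \<Longrightarrow> nrm (unit_vec K i) = 1"
proof -
  assume i: "i < K"
  have "(nrm (unit_vec K i))\<^sup>2 = (\<Sum>j<K. if j = i then 1 else 0)"
    unfolding nrm_power2 by (intro sum.cong) (use i in \<open>auto simp: unit_vec_def\<close>)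
  also have "\<dots> = 1" using i by simp
  finally have "(nrm (unit_vec K i))\<^sup>2 = 1\<^sup>2" by simp
  then show ?thesis by (rule power2_eq_imp_eq) simp_all
qed

text \<open>Expanding the squared modulus gives a double sum over columns; summing over the rows
  first meets \<open>mat_adjoint U * U\<close>, that is, the orthonormality of the columns. The
  coefficients form a function \<open>c\<close>, so that the lemma applies to each block of a longer
  vector.\<close>

lemma unitary_isometry:
  assumes U: "unitary_mat U" "U \<in> carrier_mat d d"
  shows "(\<Sum>i<d. (cmod (\<Sum>j<d. U $$ (i, j) * c j))\<^sup>2) = (\<Sum>j<d. (cmod (c j))\<^sup>2)"
proof -
  have orth: "(\<Sum>i<d. cnj (U $$ (i, j)) * U $$ (i, k)) = (if j = k then 1 else 0)"
    if "j < d" "k < d" for j k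
  proof -
    have "(mat_adjoint U * U) $$ (j, k) = (1\<^sub>m d) $$ (j, k)"
      using U by (simp add: unitary_mat_def)
    then show ?thesis using that U(2)
      by (simp add: mat_adjoint_def scalar_prod_def lessThan_atLeast0 one_mat_def)
  qed
  have "complex_of_real (\<Sum>i<d. (cmod (\<Sum>j<d. U $$ (i, j) * c j))\<^sup>2) =
      (\<Sum>i<d. (\<Sum>k<d. U $$ (i, k) * c k) * (\<Sum>j<d. cnj (U $$ (i, j)) * cnj (c j)))"
    by (simp add: complex_norm_square del: of_real_power)
  also have "\<dots> = (\<Sum>i<d. \<Sum>k<d. \<Sum>j<d. (cnj (U $$ (i, j)) * U $$ (i, k)) * (c k * cnj (c j)))"
    by (simp add: sum_product algebra_simps)
  also have "\<dots> = (\<Sum>k<d. \<Sum>i<d. \<Sum>j<d. (cnj (U $$ (i, j)) * U $$ (i, k)) * (c k * cnj (c j)))"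
    by (rule sum.swap)
  also have "\<dots> = (\<Sum>k<d. \<Sum>j<d. \<Sum>i<d. (cnj (U $$ (i, j)) * U $$ (i, k)) * (c k * cnj (c j)))"
    by (intro sum.cong refl sum.swap)
  also have "\<dots> = (\<Sum>k<d. \<Sum>j<d. (if j = k then 1 else 0) * (c k * cnj (c j)))"
    by (simp only: sum_distrib_right[symmetric]) (intro sum.cong refl, simp add: orth)
  also have "\<dots> = (\<Sum>k<d. c k * cnj (c k))"
    by (intro sum.cong refl) (simp add: if_distrib[of "\<lambda>x. x * _"] cong: if_cong)
  also have "\<dots> = complex_of_real (\<Sum>j<d. (cmod (c j))\<^sup>2)"
    by (simp add: complex_norm_square del: of_real_power)
  finally show ?thesis using of_real_eq_iff by blast
qed

lemma nths_compl_inject: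
  "length s = length s' \<Longrightarrow> nths s G = nths s' G \<Longrightarrow> nths s (- G) = nths s' (- G) \<Longrightarrow> s = s'"
proof (induction s s' arbitrary: G rule: list_induct2)
  case (Cons x xs y ys)
  have *: "{j. Suc j \<notin> G} = - {j. Suc j \<in> G}" by auto
  show ?case
    using Cons.IH[of "{j. Suc j \<in> G}"] Cons.prems
    by (cases "0 \<in> G") (simp_all add: nths_Cons *)
qed simp

lemma length_bits [simp]: "length (bits N i) = N"
  by (simp add: bits_def)

lemma index_less: "length s = N \<Longrightarrow> index s < 2 ^ N"
  using horner_sum_of_bool_2_less[of s] by (auto simp: index_def)

text \<open>Cutting a basic state into its bits in \<open>G\<close> and the others is the tensor
  factorisation on the level of basis indices. The first part becomes a number, since it indexes
  entries of a gate; the rest stays a word. Surjectivity follows from injectivity by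
  counting.\<close>

lemma bij_betw_nths_split:
  assumes G: "G \<subseteq> {..<N}"
  defines "g \<equiv> card G"
  shows "bij_betw (\<lambda>i. (index (nths (bits N i) G), nths (bits N i) (- G))) {..<2 ^ N}
    ({..<2 ^ g} \<times> words (N - g))"
proof -
  let ?h = "\<lambda>i. (index (nths (bits N i) G), nths (bits N i) (- G))"
  have fin: "finite G" using G finite_subset by blast
  have "{i. i < N \<and> i \<in> G} = G" "{i. i < N \<and> i \<in> - G} = {..<N} - G" using G by auto
  then have len: "length (nths (bits N i) G) = g" "length (nths (bits N i) (- G)) = N - g" for i
    using G fin unfolding g_def by (simp_all only: length_nths length_bits card_Diff_subset card_lessThan)
  have inj: "inj_on ?h {..<2 ^ N}"
  proof (rule inj_onI)
    fix i j assume ij: "i \<in> {..<2 ^ N}" "j \<in> {..<2 ^ N}" and eq: "?h i = ?h j"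
    have e1: "nths (bits N i) G = nths (bits N j) G"
      using arg_cong[of _ _ "bits g", OF arg_cong[of _ _ fst, OF eq]]
      by (simp only: fst_conv bits_index[OF len(1)])
    have e2: "nths (bits N i) (- G) = nths (bits N j) (- G)"
      using arg_cong[of _ _ snd, OF eq] by (simp only: snd_conv)
    have "bits N i = bits N j"
      by (rule nths_compl_inject[OF _ e1 e2]) (simp only: length_bits)
    then have "index (bits N i) = index (bits N j)" by (rule arg_cong)
    then show "i = j" using ij by (simp only: index_bits lessThan_iff)
  qed
  have "?h ` {..<2 ^ N} \<subseteq> {..<2 ^ g} \<times> words (N - g)"
    by (auto simp: words_def len intro!: index_less)
  moreover have "card (?h ` {..<2 ^ N}) = card ({..<(2::nat) ^ g} \<times> words (N - g))"
  proof -
    have "g \<le> N" using card_mono[OF _ G] by (simp add: g_def)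
    then have "(2::nat) ^ g * 2 ^ (N - g) = 2 ^ N" by (metis le_add_diff_inverse power_add)
    then show ?thesis
      by (simp only: card_image[OF inj] card_cartesian_product card_words card_lessThan)
  qed
  ultimately have "?h ` {..<2 ^ N} = {..<2 ^ g} \<times> words (N - g)"
    by (intro card_subset_eq finite_cartesian_product finite_lessThan finite_words)
  with inj show ?thesis unfolding bij_betw_def by blast
qed

text \<open>In the coordinates of the splitting the gate acts separately on each block with a fixed
  word outside \<open>G\<close>, so its isometry can be summed over the blocks.\<close>

lemma nrm_working_transform:
  assumes G: "G \<subseteq> {..<N}" and U: "unitary_mat U" "U \<in> carrier_mat (2 ^ card G) (2 ^ card G)"
    and v: "v \<in> carrier_vec (2 ^ N)"
  shows "nrm (working_transform N G U *\<^sub>v v) = nrm v"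
proof -
  define g where "g = card G"
  let ?h = "\<lambda>i. (index (nths (bits N i) G), nths (bits N i) (- G))"
  \<comment> \<open>\<open>c\<close> is \<open>v\<close> read as an array with one index for the
    qubits of the gate and one for the others.\<close>
  define c where "c = (\<lambda>p. Matrix.vec_index v (the_inv_into {..<2 ^ N} ?h p))"
  note bij = bij_betw_nths_split[OF G, folded g_def]
  have ch: "c (?h i) = Matrix.vec_index v i" if "i < 2 ^ N" for i
    using the_inv_into_f_f[OF bij_betw_imp_inj_on[OF bij], of i] that by (simp add: c_def)
  have entry: "Matrix.vec_index (working_transform N G U *\<^sub>v v) i =
      (\<Sum>j<2 ^ g. U $$ (fst (?h i), j) * c (j, snd (?h i)))" (is "?L = ?R") if i: "i < 2 ^ N" for i
  proof -
    have "?L = (\<Sum>j<2 ^ N. (if snd (?h i) = snd (?h j) then U $$ (fst (?h i), fst (?h j)) else 0)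
        * Matrix.vec_index v j)"
      using i v by (simp add: working_transform_def scalar_prod_def lessThan_atLeast0 cong: if_cong)
    also have "\<dots> = (\<Sum>j<2 ^ N. (\<lambda>(a, r). (if snd (?h i) = r then U $$ (fst (?h i), a) else 0)
        * c (a, r)) (?h j))"
      by (intro sum.cong refl) (simp add: ch)
    also have "\<dots> = (\<Sum>(a, r) \<in> {..<2 ^ g} \<times> words (N - g).
        (if snd (?h i) = r then U $$ (fst (?h i), a) else 0) * c (a, r))"
      by (rule sum.reindex_bij_betw[OF bij])
    also have "\<dots> = (\<Sum>a<2 ^ g. \<Sum>r\<in>words (N - g).
        if r = snd (?h i) then U $$ (fst (?h i), a) * c (a, r) else 0)"
      by (subst sum.cartesian_product[symmetric]) (intro sum.cong refl, auto)
    also have "\<dots> = ?R"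
      using bij_betwE[OF bij] i by (intro sum.cong refl) (auto simp: sum.delta)
    finally show ?thesis .
  qed
  have "(nrm (working_transform N G U *\<^sub>v v))\<^sup>2 =
      (\<Sum>i<2 ^ N. (\<lambda>(a, r). (cmod (\<Sum>j<2 ^ g. U $$ (a, j) * c (j, r)))\<^sup>2) (?h i))"
  proof -
    have "dim_vec (working_transform N G U *\<^sub>v v) = 2 ^ N" by (simp add: working_transform_def)
    then show ?thesis
      unfolding nrm_power2 by (intro sum.cong) (simp_all only: entry lessThan_iff split_beta)
  qed
  also have "\<dots> = (\<Sum>(a, r) \<in> {..<2 ^ g} \<times> words (N - g).
      (cmod (\<Sum>j<2 ^ g. U $$ (a, j) * c (j, r)))\<^sup>2)"
    by (rule sum.reindex_bij_betw[OF bij])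
  also have "\<dots> = (\<Sum>r\<in>words (N - g). \<Sum>a<2 ^ g. (cmod (\<Sum>j<2 ^ g. U $$ (a, j) * c (j, r)))\<^sup>2)"
    by (subst sum.cartesian_product[symmetric]) (rule sum.swap)
  also have "\<dots> = (\<Sum>r\<in>words (N - g). \<Sum>a<2 ^ g. (cmod (c (a, r)))\<^sup>2)"
    using U by (intro sum.cong refl unitary_isometry) (auto simp: g_def)
  also have "\<dots> = (\<Sum>(a, r) \<in> {..<2 ^ g} \<times> words (N - g). (cmod (c (a, r)))\<^sup>2)"
    by (subst sum.cartesian_product[symmetric]) (rule sum.swap)
  also have "\<dots> = (\<Sum>i<2 ^ N. (\<lambda>(a, r). (cmod (c (a, r)))\<^sup>2) (?h i))"
    by (rule sum.reindex_bij_betw[OF bij, symmetric])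
  also have "\<dots> = (nrm v)\<^sup>2"
    unfolding nrm_power2 using v by (intro sum.cong) (auto simp: ch)
  finally show ?thesis by simp
qed

section \<open>The query transform as a permutation of basic states\<close>

lemma length_query_basis:
  assumes "length s = t + 2 * n" "\<And>a. length a = n \<Longrightarrow> length (f a) = n"
  shows "length (query_basis f t n s) = t + 2 * n"
  using assms by (simp add: query_basis_def Let_def)

lemma query_address_query_basis:
  assumes "length s = t + 2 * n"
  shows "take n (drop t (query_basis f t n s)) = take n (drop t s)"
  using assms by (simp add: query_basis_def Let_def)

text \<open>The address survives the first query, so both queries add the same word modulo 2 and the
  second cancels the first.\<close>

lemma query_basis_involution:
  assumes "length s = t + 2 * n" "\<And>a. length a = n \<Longrightarrow> length (f a) = n"
  shows "query_basis f t n (query_basis f t n s) = s"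
proof -
  define w a b where "w = take t s" "a = take n (drop t s)" "b = drop (t + n) s"
  have "drop (n + t) s = drop n (drop t s)" by simp
  then have s: "s = w @ a @ b"
    unfolding w_a_b_def by (metis append_take_drop_id add.commute)
  have l: "length w = t" "length a = n" "length b = n" "length (f a) = n"
    using assms by (auto simp: w_a_b_def)
  have "map2 (\<noteq>) x (map2 (\<noteq>) x y) = y" if "length x = length y" for x y :: "bool list"
    using that by (induction x y rule: list_induct2) auto
  then show ?thesis using l by (simp add: s query_basis_def Let_def)
qed

definition query_index :: "(bool list \<Rightarrow> bool list) \<Rightarrow> nat \<Rightarrow> nat \<Rightarrow> nat \<Rightarrow> nat" where
  "query_index f t n i = index (query_basis f t n (bits (t + 2 * n) i))"

definition query_address :: "nat \<Rightarrow> nat \<Rightarrow> nat \<Rightarrow> bool list" where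
  "query_address t n i = take n (drop t (bits (t + 2 * n) i))"

lemma query_address_words: "query_address t n i \<in> words n"
  by (simp add: query_address_def words_def)

context
  fixes f :: "bool list \<Rightarrow> bool list" and t n :: nat
  assumes f: "\<And>a. length a = n \<Longrightarrow> length (f a) = n"
begin

lemma query_index_less: "query_index f t n i < 2 ^ (t + 2 * n)"
  using f by (auto simp: query_index_def intro!: index_less length_query_basis)

lemma bits_query_index: "bits (t + 2 * n) (query_index f t n i) = query_basis f t n (bits (t + 2 * n) i)"
  using f by (auto simp: query_index_def intro!: bits_index length_query_basis)

lemma query_index_involution: "i < 2 ^ (t + 2 * n) \<Longrightarrow> query_index f t n (query_index f t n i) = i"
  unfolding query_index_def[of f t n "query_index f t n i"] bits_query_index
  using f by (simp add: query_basis_involution index_bits)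

lemma query_address_query_index: "query_address t n (query_index f t n i) = query_address t n i"
  by (simp add: query_address_def bits_query_index query_address_query_basis)

text \<open>The matrix moves basis vector \<open>j\<close> to \<open>query_index f t n j\<close>. As
  this permutation is its own inverse, it also tells which coordinate of \<open>v\<close> arrives at
  \<open>i\<close>.\<close>

lemma query_transform_entry:
  assumes "v \<in> carrier_vec (2 ^ (t + 2 * n))" "i < 2 ^ (t + 2 * n)"
  shows "Matrix.vec_index (query_transform f t n *\<^sub>v v) i = Matrix.vec_index v (query_index f t n i)"
proof -
  let ?N = "t + 2 * n"
  have iff: "bits ?N i = query_basis f t n (bits ?N j) \<longleftrightarrow> j = query_index f t n i"
    if "j < 2 ^ ?N" for j
  proof
    assume "bits ?N i = query_basis f t n (bits ?N j)"
    then have "i = query_index f t n j"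
      using assms(2) index_bits by (metis query_index_def)
    then show "j = query_index f t n i" using query_index_involution[OF that] by simp
  next
    assume "j = query_index f t n i"
    then show "bits ?N i = query_basis f t n (bits ?N j)"
      using bits_query_index[of j] query_index_involution[OF assms(2)] by simp
  qed
  have "Matrix.vec_index (query_transform f t n *\<^sub>v v) i =
      (\<Sum>j<2 ^ ?N. (if bits ?N i = query_basis f t n (bits ?N j) then 1 else 0) * Matrix.vec_index v j)"
    using assms by (simp add: query_transform_def scalar_prod_def lessThan_atLeast0)
  also have "\<dots> = (\<Sum>j<2 ^ ?N. if j = query_index f t n i then Matrix.vec_index v j else 0)"
    by (intro sum.cong refl) (simp add: iff)
  finally show ?thesis using query_index_less by simp
qed

text \<open>A query never alters its address, so the permutation acts within each address class.
  \<open>S = UNIV\<close> yields the isometry of the query; smaller sets localise the difference of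
  two oracles.\<close>

lemma bij_betw_query_index:
  "bij_betw (query_index f t n) {i. i < 2 ^ (t + 2 * n) \<and> query_address t n i \<in> S}
     {i. i < 2 ^ (t + 2 * n) \<and> query_address t n i \<in> S}"
  by (rule bij_betw_byWitness[where f' = "query_index f t n"])
     (auto simp: query_index_involution query_index_less query_address_query_index)

lemma nrm_query_transform:
  assumes v: "v \<in> carrier_vec (2 ^ (t + 2 * n))"
  shows "nrm (query_transform f t n *\<^sub>v v) = nrm v"
proof -
  let ?K = "2 ^ (t + 2 * n) :: nat"
  have dim: "dim_vec (query_transform f t n *\<^sub>v v) = ?K" "dim_vec v = ?K"
    using v by (simp_all add: query_transform_def)
  have "(nrm (query_transform f t n *\<^sub>v v))\<^sup>2 =
      (\<Sum>i<?K. (cmod (Matrix.vec_index v (query_index f t n i)))\<^sup>2)"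
    unfolding nrm_power2 dim
    by (intro sum.cong refl) (simp only: query_transform_entry[OF v] lessThan_iff)
  also have "\<dots> = (\<Sum>i<?K. (cmod (Matrix.vec_index v i))\<^sup>2)"
    using sum.reindex_bij_betw[OF bij_betw_query_index[of UNIV],
        of "\<lambda>i. (cmod (Matrix.vec_index v i))\<^sup>2"]
    by (simp only: lessThan_def UNIV_I simp_thms)
  also have "\<dots> = (nrm v)\<^sup>2"
    unfolding nrm_power2 dim ..
  finally show ?thesis by (rule power2_eq_imp_eq) (rule nrm_nonneg)+
qed

end

section \<open>Query mass: the distribution of the address register\<close>

definition query_mass :: "nat \<Rightarrow> nat \<Rightarrow> complex Matrix.vec \<Rightarrow> bool list \<Rightarrow> real" where
  "query_mass t n v z =
     (\<Sum>i | i < 2 ^ (t + 2 * n) \<and> query_address t n i = z. (cmod (Matrix.vec_index v i))\<^sup>2)"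

lemma query_mass_nonneg: "query_mass t n v z \<ge> 0"
  by (simp add: query_mass_def sum_nonneg)

lemma sum_query_mass:
  assumes "finite S"
  shows "(\<Sum>z\<in>S. query_mass t n v z) =
    (\<Sum>i | i < 2 ^ (t + 2 * n) \<and> query_address t n i \<in> S. (cmod (Matrix.vec_index v i))\<^sup>2)"
proof -
  have "(\<Sum>z\<in>S. query_mass t n v z) = (\<Sum>z\<in>S.
      \<Sum>i | i \<in> {i. i < 2 ^ (t + 2 * n) \<and> query_address t n i \<in> S} \<and> query_address t n i = z.
        (cmod (Matrix.vec_index v i))\<^sup>2)"
    unfolding query_mass_def by (intro sum.cong) auto
  also have "\<dots> = (\<Sum>i | i < 2 ^ (t + 2 * n) \<and> query_address t n i \<in> S.
      (cmod (Matrix.vec_index v i))\<^sup>2)"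
    by (rule sum.group) (use assms in auto)
  finally show ?thesis .
qed

lemma sum_query_mass_words:
  assumes "v \<in> carrier_vec (2 ^ (t + 2 * n))"
  shows "(\<Sum>z\<in>words n. query_mass t n v z) = (nrm v)\<^sup>2"
  using assms by (simp add: sum_query_mass query_address_words nrm_power2 lessThan_def)

text \<open>The two permutations agree at every address outside \<open>S\<close>. At the others
  \<open>|x - y|^2 \<le> 2 |x|^2 + 2 |y|^2\<close>, and each permutation preserves the mass on
  \<open>S\<close>, whence the factor 4.\<close>

lemma nrm_query_transform_diff:
  assumes v: "v \<in> carrier_vec (2 ^ (t + 2 * n))"
    and f: "\<And>a. length a = n \<Longrightarrow> length (f a) = n"
    and g: "\<And>a. length a = n \<Longrightarrow> length (g a) = n"
    and S: "finite S" and eq: "\<And>a. length a = n \<Longrightarrow> a \<notin> S \<Longrightarrow> f a = g a"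
  shows "(nrm (query_transform f t n *\<^sub>v v - query_transform g t n *\<^sub>v v))\<^sup>2 \<le>
    4 * (\<Sum>z\<in>S. query_mass t n v z)"
proof -
  let ?N = "2 ^ (t + 2 * n)" and ?A = "{i. i < 2 ^ (t + 2 * n) \<and> query_address t n i \<in> S}"
  let ?d = "\<lambda>i. Matrix.vec_index v (query_index f t n i) - Matrix.vec_index v (query_index g t n i)"
  have dim: "dim_vec (query_transform f t n *\<^sub>v v - query_transform g t n *\<^sub>v v) = ?N"
    by (simp add: query_transform_def)
  have "query_basis f t n s = query_basis g t n s"
    if "length s = t + 2 * n" "take n (drop t s) \<notin> S" for s
    using eq[of "take n (drop t s)"] that by (simp add: query_basis_def Let_def)
  then have "query_index f t n i = query_index g t n i" if "query_address t n i \<notin> S" for i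
    using that by (simp add: query_index_def query_address_def)
  then have zero: "?d i = 0" if "query_address t n i \<notin> S" for i using that by simp
  have "(nrm (query_transform f t n *\<^sub>v v - query_transform g t n *\<^sub>v v))\<^sup>2 = (\<Sum>i<?N. (cmod (?d i))\<^sup>2)"
    unfolding nrm_power2 dim
    by (intro sum.cong refl, subst index_minus_vec)
       (simp_all add: query_transform_entry[OF f v] query_transform_entry[OF g v],
        simp add: query_transform_def)
  also have "\<dots> = (\<Sum>i\<in>?A. (cmod (?d i))\<^sup>2)"
    using zero by (intro sum.mono_neutral_right) auto
  also have "\<dots> \<le> (\<Sum>i\<in>?A. 2 * (cmod (Matrix.vec_index v (query_index f t n i)))\<^sup>2 +
      2 * (cmod (Matrix.vec_index v (query_index g t n i)))\<^sup>2)"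
  proof (rule sum_mono)
    fix i
    let ?a = "Matrix.vec_index v (query_index f t n i)" and ?b = "Matrix.vec_index v (query_index g t n i)"
    have "(cmod (?a - ?b))\<^sup>2 \<le> (cmod ?a + cmod ?b)\<^sup>2"
      by (intro power_mono norm_triangle_ineq4) auto
    also have "\<dots> \<le> 2 * (cmod ?a)\<^sup>2 + 2 * (cmod ?b)\<^sup>2"
      using sum_squares_bound[of "cmod ?a" "cmod ?b"] by (simp add: power2_sum)
    finally show "(cmod (?a - ?b))\<^sup>2 \<le> 2 * (cmod ?a)\<^sup>2 + 2 * (cmod ?b)\<^sup>2" .
  qed
  also have "\<dots> = 2 * (\<Sum>i\<in>?A. (cmod (Matrix.vec_index v (query_index f t n i)))\<^sup>2) +
      2 * (\<Sum>i\<in>?A. (cmod (Matrix.vec_index v (query_index g t n i)))\<^sup>2)"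
    by (simp add: sum.distrib sum_distrib_left)
  also have "\<dots> = 4 * (\<Sum>i\<in>?A. (cmod (Matrix.vec_index v i))\<^sup>2)"
    using sum.reindex_bij_betw[OF bij_betw_query_index[OF f, where t = t and S = S], where g = "\<lambda>i. (cmod (Matrix.vec_index v i))\<^sup>2"]
      sum.reindex_bij_betw[OF bij_betw_query_index[OF g, where t = t and S = S], where g = "\<lambda>i. (cmod (Matrix.vec_index v i))\<^sup>2"]
    by simp
  finally show ?thesis using S by (simp add: sum_query_mass)
qed

subsection \<open>Hybrid runs\<close>

definition step_matrix ::
    "(bool list \<Rightarrow> bool list) \<Rightarrow> machine \<Rightarrow> (nat \<Rightarrow> nat) \<Rightarrow> bool list \<Rightarrow> nat \<Rightarrow> complex mat" where
  "step_matrix f C \<tau> a i =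
     (let n = length a; t = \<tau> n; D = classical_state C a i
      in if control D = q_w
           then working_transform (t + 2 * n) (marked_cells t n D) (gate C (control D))
         else if control D = q_q then query_transform f t n
         else 1\<^sub>m (2 ^ (t + 2 * n)))"

text \<open>A run whose oracle varies with time: step \<open>i\<close> consults \<open>F i\<close>.
  The constant family gives the actual run.\<close>

primrec hybrid_state ::
    "(nat \<Rightarrow> bool list \<Rightarrow> bool list) \<Rightarrow> machine \<Rightarrow> (nat \<Rightarrow> nat) \<Rightarrow> bool list \<Rightarrow> nat \<Rightarrow> complex Matrix.vec" where
  "hybrid_state F C \<tau> a 0 = unit_vec (2 ^ (\<tau> (length a) + 2 * length a)) 0"
| "hybrid_state F C \<tau> a (Suc i) = step_matrix (F i) C \<tau> a i *\<^sub>v hybrid_state F C \<tau> a i"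

text \<open>The classical part runs without access to the oracle, so the query times depend on the
  machine and the input only.\<close>

definition query_times :: "machine \<Rightarrow> bool list \<Rightarrow> nat \<Rightarrow> nat set" where
  "query_times C a i = {j. j < i \<and> control (classical_state C a j) = q_q}"

lemma finite_query_times [simp]: "finite (query_times C a i)"
  by (simp add: query_times_def)

lemma query_times_Suc:
  "query_times C a (Suc i) =
    (if control (classical_state C a i) = q_q then insert i (query_times C a i)
     else query_times C a i)"
  by (auto simp: query_times_def less_Suc_eq)

lemma card_query_times_less:
  "j \<in> query_times C a i \<Longrightarrow> card (query_times C a j) < card (query_times C a i)"
  by (rule psubset_card_mono) (auto simp: query_times_def)

lemma evaluations_eq: "evaluations C \<tau> a = card (query_times C a (\<tau> (length a)))"
  by (simp add: evaluations_def query_times_def)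

lemma step_matrix_carrier:
  "step_matrix f C \<tau> a i \<in>
    carrier_mat (2 ^ (\<tau> (length a) + 2 * length a)) (2 ^ (\<tau> (length a) + 2 * length a))"
  by (simp add: step_matrix_def Let_def working_transform_def query_transform_def)

lemma hybrid_state_carrier:
  "hybrid_state F C \<tau> a i \<in> carrier_vec (2 ^ (\<tau> (length a) + 2 * length a))"
  by (induction i) (auto intro: mult_mat_vec_carrier step_matrix_carrier)

lemma quantum_state_eq_hybrid_state: "quantum_state f C \<tau> a i = hybrid_state (\<lambda>_. f) C \<tau> a i"
proof (induction i)
  case (Suc i)
  then show ?case
    using hybrid_state_carrier[of "\<lambda>_. f" C \<tau> a i] by (simp add: step_matrix_def Let_def)
qed simp

text \<open>Oracles are consulted at query times only. This is the source of all independence below: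
  the state at time \<open>i\<close> is a function of the oracles at earlier query times.\<close>

lemma hybrid_state_cong:
  "(\<And>j. j \<in> query_times C a i \<Longrightarrow> F j = F' j) \<Longrightarrow> hybrid_state F C \<tau> a i = hybrid_state F' C \<tau> a i"
proof (induction i)
  case (Suc i)
  have "step_matrix (F i) C \<tau> a i = step_matrix (F' i) C \<tau> a i"
    using Suc.prems[of i] by (simp add: step_matrix_def query_times_Suc Let_def split: if_splits)
  moreover have "hybrid_state F C \<tau> a i = hybrid_state F' C \<tau> a i"
    by (rule Suc.IH) (simp add: Suc.prems query_times_Suc)
  ultimately show ?case by simp
qed simp

lemma marked_cells_subset: "marked_cells t n D \<subseteq> {..<t + 2 * n}"
  by (auto simp: marked_cells_def)

lemma halts_with_unique:
  assumes "halts_with n M D w" "halts_with n M D w'" "length w = length w'"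
  shows "w = w'"
proof -
  obtain k where k: "control ((step n M ^^ k) D) = q_o"
      "\<forall>j<k. control ((step n M ^^ j) D) \<noteq> q_o"
      "\<forall>i<length w. contents ((step n M ^^ k) D) Work i = Bit (w ! i)"
    using assms(1) unfolding halts_with_def by blast
  obtain l where l: "control ((step n M ^^ l) D) = q_o"
      "\<forall>j<l. control ((step n M ^^ j) D) \<noteq> q_o"
      "\<forall>i<length w'. contents ((step n M ^^ l) D) Work i = Bit (w' ! i)"
    using assms(2) unfolding halts_with_def by blast
  have "k = l" using k(1,2) l(1,2) by (metis linorder_neqE_nat)
  then show ?thesis using k(3) l(3) assms(3) by (intro nth_equalityI) auto
qed

context
  fixes \<U> :: "complex mat set" and C :: machine and \<tau> :: "nat \<Rightarrow> nat" and a :: "bool list"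
  assumes machine: "query_machine \<U> C \<tau>"
    and unitary: "\<And>U. U \<in> \<U> \<Longrightarrow> unitary_mat U"
begin

abbreviation (input) "width \<equiv> \<tau> (length a)"

abbreviation (input) "num_states \<equiv> (2::nat) ^ (width + 2 * length a)"

lemma nrm_step_matrix:
  assumes f: "\<And>b. length b = length a \<Longrightarrow> length (f b) = length a"
    and i: "i < width" and v: "v \<in> carrier_vec num_states"
  shows "nrm (step_matrix f C \<tau> a i *\<^sub>v v) = nrm v"
proof -
  let ?D = "classical_state C a i"
  consider "control ?D = q_w" | "control ?D = q_q" | "control ?D \<noteq> q_w" "control ?D \<noteq> q_q" by blast
  then show ?thesis
  proof cases
    case 1
    have "\<forall>i \<le> width. control (classical_state C a i) = q_w \<longrightarrow>
        gate C (control (classical_state C a i)) \<in>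
          carrier_mat (2 ^ card (marked_cells width (length a) (classical_state C a i)))
            (2 ^ card (marked_cells width (length a) (classical_state C a i)))"
      using machine unfolding query_machine_def Let_def by blast
    then have "gate C q_w \<in> carrier_mat (2 ^ card (marked_cells width (length a) ?D))
        (2 ^ card (marked_cells width (length a) ?D))"
      using i 1 by (metis less_imp_le)
    moreover have "unitary_mat (gate C q_w)"
      using machine unitary by (auto simp: query_machine_def)
    ultimately show ?thesis
      using 1 nrm_working_transform[OF marked_cells_subset _ _ v] by (simp add: step_matrix_def Let_def)
  next
    case 2
    then show ?thesis using nrm_query_transform[OF f v] by (simp add: step_matrix_def Let_def)
  next
    case 3
    then show ?thesis using v by (simp add: step_matrix_def Let_def)
  qed
qed

lemma nrm_hybrid_state:
  assumes F: "\<And>j b. length b = length a \<Longrightarrow> length (F j b) = length a"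
    and "i \<le> width"
  shows "nrm (hybrid_state F C \<tau> a i) = 1"
  using assms(2)
proof (induction i)
  case (Suc i)
  then show ?case using nrm_step_matrix[of "F i" i, OF F _ hybrid_state_carrier[of F C \<tau> a i]] by simp
qed (simp add: nrm_unit_vec)

text \<open>The error splits as \<open>A v - B w = A (v - w) + (A w - B w)\<close>. The isometry
  \<open>A\<close> preserves the old error, and a query adds one bounded by the mass it puts on
  \<open>S j\<close>. That mass is taken in the run of \<open>G\<close>, which can be arranged to be
  independent of the points of \<open>S j\<close>.\<close>

lemma nrm_hybrid_state_diff:
  assumes F: "\<And>j b. length b = length a \<Longrightarrow> length (F j b) = length a"
    and G: "\<And>j b. length b = length a \<Longrightarrow> length (G j b) = length a"
    and S: "\<And>j. finite (S j)"
    and eq: "\<And>j b. j \<in> query_times C a width \<Longrightarrow> length b = length a \<Longrightarrow> b \<notin> S j \<Longrightarrow> F j b = G j b"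
    and "i \<le> width"
  shows "nrm (hybrid_state F C \<tau> a i - hybrid_state G C \<tau> a i) \<le>
    (\<Sum>j\<in>query_times C a i. 2 * sqrt (\<Sum>z\<in>S j. query_mass width (length a) (hybrid_state G C \<tau> a j) z))"
  using assms(5)
proof (induction i)
  case 0
  have "unit_vec num_states 0 - unit_vec num_states 0 = (0\<^sub>v num_states :: complex Matrix.vec)"
    by simp
  then show ?case by (simp add: query_times_def nrm_def L2_set_def)
next
  case (Suc i)
  let ?v = "hybrid_state F C \<tau> a i" and ?w = "hybrid_state G C \<tau> a i"
  let ?A = "step_matrix (F i) C \<tau> a i" and ?B = "step_matrix (G i) C \<tau> a i"
  let ?m = "\<lambda>j. 2 * sqrt (\<Sum>z\<in>S j. query_mass width (length a) (hybrid_state G C \<tau> a j) z)"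
  note v = hybrid_state_carrier[of F C \<tau> a i] and w = hybrid_state_carrier[of G C \<tau> a i]
  note A = step_matrix_carrier[of "F i" C \<tau> a i] and B = step_matrix_carrier[of "G i" C \<tau> a i]
  have Av: "?A *\<^sub>v ?v \<in> carrier_vec num_states" "?A *\<^sub>v ?w \<in> carrier_vec num_states"
    "?B *\<^sub>v ?w \<in> carrier_vec num_states"
    using A B v w by (auto intro: mult_mat_vec_carrier)
  have "x - z = (x - y) + (y - z)" if "x \<in> carrier_vec K" "y \<in> carrier_vec K" "z \<in> carrier_vec K"
    for x y z :: "complex Matrix.vec" and K
    using that by (intro eq_vecI) auto
  from this[OF Av] have "?A *\<^sub>v ?v - ?B *\<^sub>v ?w = ?A *\<^sub>v (?v - ?w) + (?A *\<^sub>v ?w - ?B *\<^sub>v ?w)"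
    unfolding mult_minus_distrib_mat_vec[OF A v w] .
  then have "nrm (?A *\<^sub>v ?v - ?B *\<^sub>v ?w) \<le> nrm (?A *\<^sub>v (?v - ?w)) + nrm (?A *\<^sub>v ?w - ?B *\<^sub>v ?w)"
    using Av A v w
    by (auto intro!: nrm_triangle[of _ num_states] mult_mat_vec_carrier)
  also have "nrm (?A *\<^sub>v (?v - ?w)) = nrm (?v - ?w)"
    using Suc.prems v w by (intro nrm_step_matrix F) auto
  also have "nrm (?v - ?w) \<le> (\<Sum>j\<in>query_times C a i. ?m j)"
    using Suc by simp
  finally have *: "nrm (?A *\<^sub>v ?v - ?B *\<^sub>v ?w) \<le>
      (\<Sum>j\<in>query_times C a i. ?m j) + nrm (?A *\<^sub>v ?w - ?B *\<^sub>v ?w)" by simp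
  show ?case
  proof (cases "control (classical_state C a i) = q_q")
    case True
    have i: "i \<in> query_times C a width" using True Suc.prems by (simp add: query_times_def)
    have "(nrm (?A *\<^sub>v ?w - ?B *\<^sub>v ?w))\<^sup>2 \<le>
        4 * (\<Sum>z\<in>S i. query_mass width (length a) ?w z)"
      using True nrm_query_transform_diff[OF w, of "F i" "G i" "S i"] F G S eq[OF i]
      by (simp add: step_matrix_def Let_def)
    then have "nrm (?A *\<^sub>v ?w - ?B *\<^sub>v ?w) \<le> sqrt (4 * (\<Sum>z\<in>S i. query_mass width (length a) ?w z))"
      by (simp add: real_le_rsqrt)
    also have "\<dots> = ?m i" by (simp add: real_sqrt_mult)
    finally have "nrm (?A *\<^sub>v ?w - ?B *\<^sub>v ?w) \<le> ?m i" .
    moreover have "i \<notin> query_times C a i" by (simp add: query_times_def)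
    ultimately show ?thesis using * True by (simp add: query_times_Suc)
  next
    case False
    then have "?A = ?B" by (simp add: step_matrix_def Let_def)
    then have "?A *\<^sub>v ?w - ?B *\<^sub>v ?w = 0\<^sub>v num_states" using Av by simp
    moreover have "nrm (0\<^sub>v num_states) = 0" by (simp add: nrm_def L2_set_def)
    ultimately show ?thesis using * False by (simp add: query_times_Suc)
  qed
qed

section \<open>Probabilities of the readout words\<close>

definition outcomes :: "bool list \<Rightarrow> nat set" where
  "outcomes w = {i. i < num_states \<and>
     halts_with (length a) (readout C) (readout_start (readout C) width (length a)
       (classical_state C a width) (bits (width + 2 * length a) i)) w}"

lemma output_prob_eq:
  "output_prob f C \<tau> a w =
    (\<Sum>i\<in>outcomes w. (cmod (Matrix.vec_index (hybrid_state (\<lambda>_. f) C \<tau> a width) i))\<^sup>2)"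
  by (simp add: output_prob_def outcomes_def Let_def quantum_state_eq_hybrid_state)

text \<open>The readout is deterministic, so one observation cannot yield two words of the same
  length: the outcome sets are disjoint and their probabilities add up.\<close>

lemma sum_outcomes_le:
  assumes v: "v \<in> carrier_vec num_states"
  shows "(\<Sum>w\<in>words n. \<Sum>i\<in>outcomes w. (cmod (Matrix.vec_index v i))\<^sup>2) \<le> (nrm v)\<^sup>2"
proof -
  have "(\<Sum>w\<in>words n. \<Sum>i\<in>outcomes w. (cmod (Matrix.vec_index v i))\<^sup>2) =
      (\<Sum>i\<in>(\<Union>w\<in>words n. outcomes w). (cmod (Matrix.vec_index v i))\<^sup>2)"
    by (rule sum.UNION_disjoint[symmetric])
       (auto simp: outcomes_def words_def[symmetric], auto simp: words_def dest: halts_with_unique)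
  also have "\<dots> \<le> (\<Sum>i<num_states. (cmod (Matrix.vec_index v i))\<^sup>2)"
    by (rule sum_mono2) (auto simp: outcomes_def)
  also have "\<dots> = (nrm v)\<^sup>2" using v by (simp add: nrm_power2)
  finally show ?thesis .
qed

text \<open>Amplitudes are compared by \<open>|x|^2 \<le> 2 |y|^2 + 2 |x - y|^2\<close>.
  Cauchy-Schwarz turns the squared sum of query errors into the number of queries times a sum of
  query masses, which is suited to averaging. The constant 8 is this 2 times the square of the 2 in
  each query error.\<close>

lemma output_prob_hybrid:
  assumes f: "\<And>b. length b = length a \<Longrightarrow> length (f b) = length a"
    and G: "\<And>j b. length b = length a \<Longrightarrow> length (G j b) = length a"
    and S: "\<And>j. finite (S j)"
    and eq: "\<And>j b. j \<in> query_times C a width \<Longrightarrow> length b = length a \<Longrightarrow> b \<notin> S j \<Longrightarrow> f b = G j b"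
  shows "output_prob f C \<tau> a w \<le>
    2 * (\<Sum>i\<in>outcomes w. (cmod (Matrix.vec_index (hybrid_state G C \<tau> a width) i))\<^sup>2) +
    8 * real (card (query_times C a width)) * (\<Sum>j\<in>query_times C a width.
      \<Sum>z\<in>S j. query_mass width (length a) (hybrid_state G C \<tau> a j) z)"
proof -
  let ?v = "hybrid_state (\<lambda>_. f) C \<tau> a width" and ?w = "hybrid_state G C \<tau> a width"
  let ?J = "query_times C a width"
  let ?m = "\<lambda>j. \<Sum>z\<in>S j. query_mass width (length a) (hybrid_state G C \<tau> a j) z"
  note v = hybrid_state_carrier[of "\<lambda>_. f" C \<tau> a width] and w = hybrid_state_carrier[of G C \<tau> a width]
  have m: "?m j \<ge> 0" for j by (simp add: sum_nonneg query_mass_nonneg)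
  have "nrm (?v - ?w) \<le> (\<Sum>j\<in>?J. 2 * sqrt (?m j))"
    by (rule nrm_hybrid_state_diff) (use assms in auto)
  then have "(nrm (?v - ?w))\<^sup>2 \<le> (\<Sum>j\<in>?J. 2 * sqrt (?m j))\<^sup>2"
    by (intro power_mono) auto
  also have "\<dots> \<le> (\<Sum>j\<in>?J. (2 * sqrt (?m j))\<^sup>2) * card ?J"
    by (rule sum_squared_le_sum_of_squares)
  also have "\<dots> = 4 * card ?J * (\<Sum>j\<in>?J. ?m j)"
    using m by (simp add: power_mult_distrib sum_distrib_left algebra_simps)
  finally have d: "(nrm (?v - ?w))\<^sup>2 \<le> 4 * card ?J * (\<Sum>j\<in>?J. ?m j)" .
  have sub: "outcomes w \<subseteq> {..<num_states}" by (auto simp: outcomes_def)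
  then have fin: "finite (outcomes w)" by (rule finite_subset) simp
  have "(\<Sum>i\<in>outcomes w. (cmod (Matrix.vec_index ?v i))\<^sup>2) \<le>
      (\<Sum>i\<in>outcomes w. 2 * (cmod (Matrix.vec_index ?w i))\<^sup>2 + 2 * (cmod (Matrix.vec_index (?v - ?w) i))\<^sup>2)"
  proof (rule sum_mono)
    fix i assume "i \<in> outcomes w"
    then have i: "i < num_states" using sub by auto
    let ?x = "Matrix.vec_index ?v i" and ?y = "Matrix.vec_index ?w i"
    have "(cmod ?x)\<^sup>2 \<le> (cmod ?y + cmod (?x - ?y))\<^sup>2"
      by (intro power_mono norm_triangle_sub) auto
    also have "\<dots> \<le> 2 * (cmod ?y)\<^sup>2 + 2 * (cmod (?x - ?y))\<^sup>2"
      using sum_squares_bound[of "cmod ?y" "cmod (?x - ?y)"] by (simp add: power2_sum)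
    also have "?x - ?y = Matrix.vec_index (?v - ?w) i" using w i by simp
    finally show "(cmod ?x)\<^sup>2 \<le> 2 * (cmod ?y)\<^sup>2 + 2 * (cmod (Matrix.vec_index (?v - ?w) i))\<^sup>2" .
  qed
  also have "\<dots> = 2 * (\<Sum>i\<in>outcomes w. (cmod (Matrix.vec_index ?w i))\<^sup>2) +
      2 * (\<Sum>i\<in>outcomes w. (cmod (Matrix.vec_index (?v - ?w) i))\<^sup>2)"
    by (simp add: sum.distrib sum_distrib_left)
  also have "(\<Sum>i\<in>outcomes w. (cmod (Matrix.vec_index (?v - ?w) i))\<^sup>2) \<le> (nrm (?v - ?w))\<^sup>2"
    unfolding nrm_power2 using sub w by (intro sum_mono2) auto
  finally show ?thesis using d by (simp add: output_prob_eq)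
qed

end

subsection \<open>Reprogramming along a chain\<close>

text \<open>The chain points are \<open>case_nat x y\<close>, that is
  \<open>x, y 0, y 1, \<dots>\<close>, and link \<open>k\<close> redirects the \<open>k\<close>-th
  point to \<open>y k\<close>. If points coincide, the later link prevails.\<close>

primrec reprogram :: "'a \<Rightarrow> (nat \<Rightarrow> 'a) \<Rightarrow> ('a \<Rightarrow> 'a) \<Rightarrow> nat \<Rightarrow> 'a \<Rightarrow> 'a" where
  "reprogram x y f 0 = f"
| "reprogram x y f (Suc k) = (reprogram x y f k)(case_nat x y k := y k)"

lemma reprogram_cong:
  "(\<And>j. j < k \<Longrightarrow> y j = y' j) \<Longrightarrow> reprogram x y f k = reprogram x y' f k"
  by (induction k) (auto split: nat.split)

lemma reprogram_in_PiE:
  assumes "f \<in> X \<rightarrow>\<^sub>E X" "x \<in> X" "\<And>j. j < k \<Longrightarrow> y j \<in> X"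
  shows "reprogram x y f k \<in> X \<rightarrow>\<^sub>E X"
  using assms(3)
proof (induction k)
  case (Suc k)
  have "case_nat x y k \<in> X" using assms(2) Suc.prems by (simp split: nat.split)
  then have "(reprogram x y f k)(case_nat x y k := y k) \<in> insert (case_nat x y k) X \<rightarrow>\<^sub>E X"
    using Suc by (intro PiE_fun_upd) auto
  then show ?case using \<open>case_nat x y k \<in> X\<close> by (simp only: insert_absorb reprogram.simps)
qed (use assms in simp)

lemma reprogram_other:
  "z \<notin> case_nat x y ` {k..<m} \<Longrightarrow> k \<le> m \<Longrightarrow> reprogram x y f m z = reprogram x y f k z"
proof (induction m)
  case (Suc m)
  then show ?case
    by (cases "k = Suc m") (auto simp: image_iff atLeastLessThanSuc)
qed simp

text \<open>Distinct chain points keep link \<open>i\<close> from being overwritten by a later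
  one.\<close>

lemma reprogram_at:
  assumes "inj_on (case_nat x y) {..<m}" "i < m"
  shows "reprogram x y f m (case_nat x y i) = y i"
proof -
  have "case_nat x y i \<notin> case_nat x y ` {Suc i..<m}"
    using assms(2) by (subst inj_on_image_mem_iff[OF assms(1)]) auto
  then show ?thesis using reprogram_other[of _ x y "Suc i" m f] assms(2) by simp
qed

text \<open>Resampling: exchanging \<open>y j\<close> with an independent \<open>v\<close> permutes
  the pairs \<open>(y, v)\<close>. As \<open>\<Phi>\<close> ignores coordinate \<open>j\<close>, the
  word \<open>y j\<close> acts as a fresh uniform one, so the average of
  \<open>\<Phi> y (y j)\<close> is at most \<open>B\<close> divided by the size of
  \<open>X\<close>.\<close>

lemma sum_PiE_independent_le:
  fixes \<Phi> :: "('i \<Rightarrow> 'a) \<Rightarrow> 'a \<Rightarrow> real" and B :: real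
  assumes X: "finite X" and I: "finite I" and j: "j \<in> I"
    and indep: "\<And>y v. \<Phi> (y(j := v)) = \<Phi> y"
    and le: "\<And>y. y \<in> I \<rightarrow>\<^sub>E X \<Longrightarrow> (\<Sum>v\<in>X. \<Phi> y v) \<le> B"
  shows "card X * (\<Sum>y\<in>I \<rightarrow>\<^sub>E X. \<Phi> y (y j)) \<le> card (I \<rightarrow>\<^sub>E X) * B"
proof -
  let ?Y = "I \<rightarrow>\<^sub>E X"
  have upd: "y(j := v) \<in> ?Y" if "y \<in> ?Y" "v \<in> X" for y v
    using that j PiE_fun_upd[of v "\<lambda>_. X" j y I] by (simp add: insert_absorb)
  have bij: "bij_betw (\<lambda>(y, v). (y(j := v), y j)) (?Y \<times> X) (?Y \<times> X)"
    by (rule bij_betw_byWitness[where f' = "\<lambda>(y, v). (y(j := v), y j)"])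
       (use upd j in \<open>auto simp: fun_upd_idem\<close>)
  have "card X * (\<Sum>y\<in>?Y. \<Phi> y (y j)) = (\<Sum>(y, v)\<in>?Y \<times> X. \<Phi> y (y j))"
    by (simp add: sum.cartesian_product[symmetric] sum_distrib_left)
  also have "\<dots> = (\<Sum>p\<in>?Y \<times> X. (\<lambda>(y, v). \<Phi> y (y j)) ((\<lambda>(y, v). (y(j := v), y j)) p))"
    by (rule sum.reindex_bij_betw[OF bij, symmetric])
  also have "\<dots> = (\<Sum>(y, v)\<in>?Y \<times> X. \<Phi> y v)"
    by (intro sum.cong) (auto simp: indep)
  also have "\<dots> = (\<Sum>y\<in>?Y. \<Sum>v\<in>X. \<Phi> y v)"
    by (simp add: sum.cartesian_product)
  also have "\<dots> \<le> card ?Y * B"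
    by (rule sum_bounded_above) (rule le)
  finally show ?thesis .
qed

lemma card_words_pos: "card (words n) > 0"
  by (simp add: card_words)

text \<open>Here \<open>f\<close> is fixed and only the chain is random. The 2 comes from guessing
  the end of the chain. The cubic term comes from fewer than \<open>T\<close> queries, each with
  fewer than \<open>T\<close> chain points still hidden, and from the Cauchy-Schwarz factor.\<close>

lemma sum_output_prob_reprogram_le:
  assumes machine: "query_machine \<U> C \<tau>" and unitary: "\<And>U. U \<in> \<U> \<Longrightarrow> unitary_mat U"
    and a: "length a = n" and evals: "evaluations C \<tau> a < T"
    and f: "f \<in> maps n"
  defines "Y \<equiv> {..<T} \<rightarrow>\<^sub>E words n"
  shows "2 ^ n * (\<Sum>y\<in>Y. output_prob (reprogram a y f T) C \<tau> a (y (T - 1))) \<le>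
    card Y * (2 + 8 * real T ^ 3)"
proof -
  \<comment> \<open>A query preceded by \<open>c\<close> others is answered with links
    \<open>0\<close> to \<open>c\<close> in place. The state before it depends on
    \<open>y 0, \<dots>, y (c - 1)\<close> alone, while its answer can be wrong only at points from
    \<open>y c\<close> on.\<close>
  define G where "G y j = reprogram a y f (Suc (card (query_times C a j)))" for y j
  define J where "J = query_times C a (\<tau> n)"
  define c where "c j = card (query_times C a j)" for j
  let ?h = "\<lambda>y. hybrid_state (G y) C \<tau> a"
  let ?X = "words n"
  have aX: "a \<in> ?X" using a by (simp add: words_def)
  have cJ: "card J < T" using evals by (simp add: evaluations_eq J_def a)
  have c: "Suc (c j) \<le> card J" if "j \<in> J" for j
    using card_query_times_less[of j C a "\<tau> n"] that by (simp add: c_def J_def)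
  have finJ: "finite J" by (simp add: J_def)
  have len: "length (reprogram a y f k b) = length a"
    if "y \<in> Y" "k \<le> T" "length b = length a" for y k b
  proof -
    have "reprogram a y f k \<in> ?X \<rightarrow>\<^sub>E ?X"
      using that f aX by (intro reprogram_in_PiE) (auto simp: Y_def maps_def)
    then show ?thesis using that a by (auto simp: words_def PiE_def Pi_def)
  qed
  \<comment> \<open>Outside \<open>J\<close> the number of links may exceed \<open>T\<close>, where
    \<open>y\<close> is undefined. Putting the identity there makes every oracle of the family
    length preserving and leaves the states up to time \<open>\<tau> n\<close> unchanged.\<close>
  define G' where "G' y j = (if j \<in> J then G y j else (\<lambda>b. b))" for y j
  have G': "?h y j = hybrid_state (G' y) C \<tau> a j" if "j \<le> \<tau> n" for y j
    by (rule hybrid_state_cong) (use that in \<open>auto simp: G'_def J_def query_times_def\<close>)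
  have lenG': "length (G' y j b) = length a" if "y \<in> Y" "length b = length a" for y j b
    using that len[of y "Suc (c j)" b] c[of j] cJ by (auto simp: G'_def G_def c_def)
  have nrm: "nrm (?h y j) = 1" if "y \<in> Y" "j \<le> \<tau> n" for y j
    using nrm_hybrid_state[OF machine unitary, of a "G' y" j] lenG' that G' by (simp add: a)
  \<comment> \<open>The interval stops short of \<open>T - 1\<close>, because no link leaves the
    last chain point \<open>y (T - 1)\<close>.\<close>
  let ?S = "\<lambda>y j. y ` {c j..<T - 1}"
  have diff: "reprogram a y f T b = G y j b" if "j \<in> J" "b \<notin> ?S y j" for y j b
  proof -
    have "case_nat a y ` {Suc (c j)..<T} \<subseteq> ?S y j"
    proof
      fix z assume "z \<in> case_nat a y ` {Suc (c j)..<T}"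
      then obtain i where i: "z = case_nat a y i" "Suc (c j) \<le> i" "i < T" by auto
      then obtain l where "i = Suc l" by (cases i) auto
      with i show "z \<in> ?S y j" by auto
    qed
    then show ?thesis
      unfolding G_def c_def[symmetric]
      using that c[of j] cJ by (intro reprogram_other) auto
  qed
  have indep: "?h (y(l := v)) i = ?h y i" if "c i \<le> l" for y l v i
  proof (rule hybrid_state_cong)
    fix j assume "j \<in> query_times C a i"
    then have "c j < l"
      using card_query_times_less[of j C a i] that by (simp add: c_def)
    then show "G (y(l := v)) j = G y j"
      unfolding G_def c_def[symmetric] by (intro reprogram_cong) auto
  qed
  define out where "out y w =
    (\<Sum>i\<in>outcomes C \<tau> a w. (cmod (Matrix.vec_index (?h y (\<tau> n)) i))\<^sup>2)" for y w
  define mass where "mass y j z = query_mass (\<tau> n) n (?h y j) z" for y j z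
  have carrier: "?h y j \<in> carrier_vec (2 ^ (\<tau> n + 2 * n))" for y j
    using hybrid_state_carrier[of "G y" C \<tau> a j] by (simp add: a)
  have single: "output_prob (reprogram a y f T) C \<tau> a (y (T - 1)) \<le>
      2 * out y (y (T - 1)) + 8 * real (card J) * (\<Sum>j\<in>J. \<Sum>l\<in>{c j..<T - 1}. mass y j (y l))"
    if y: "y \<in> Y" for y
  proof -
    have "output_prob (reprogram a y f T) C \<tau> a (y (T - 1)) \<le>
      2 * (\<Sum>i\<in>outcomes C \<tau> a (y (T - 1)). (cmod (Matrix.vec_index (hybrid_state (G' y) C \<tau> a (\<tau> (length a))) i))\<^sup>2) +
      8 * real (card (query_times C a (\<tau> (length a)))) * (\<Sum>j\<in>query_times C a (\<tau> (length a)).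
      \<Sum>z\<in>?S y j. query_mass (\<tau> (length a)) (length a) (hybrid_state (G' y) C \<tau> a j) z)"
    proof (rule output_prob_hybrid[OF machine unitary])
      fix j b assume "j \<in> query_times C a (\<tau> (length a))" "b \<notin> ?S y j"
      then show "reprogram a y f T b = G' y j b"
        using diff by (simp add: J_def G'_def a)
    qed (use y len[of y T] lenG' in auto)
    also have "\<dots> = 2 * out y (y (T - 1)) + 8 * real (card J) * (\<Sum>j\<in>J. \<Sum>z\<in>?S y j. mass y j z)"
      by (simp add: a J_def[symmetric] out_def G'[symmetric])
         (intro disjI2 sum.cong refl, simp add: mass_def G' J_def query_times_def)
    \<comment> \<open>Coinciding chain points are now counted once per index; this can only enlarge
      the sum and makes its range independent of \<open>y\<close>.\<close>
    also have "\<dots> \<le> 2 * out y (y (T - 1)) +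
        8 * real (card J) * (\<Sum>j\<in>J. \<Sum>l\<in>{c j..<T - 1}. mass y j (y l))"
      by (intro add_left_mono mult_left_mono sum_mono)
         (use sum_image_le[of "{c j..<T - 1}" "mass y j" y for y j]
            in \<open>auto simp: mass_def query_mass_nonneg o_def\<close>)
    finally show ?thesis .
  qed
  \<comment> \<open>The bound on the evaluations enters here: \<open>c (\<tau> n) = card J\<close>
    is at most \<open>T - 1\<close>, so the final state is independent of
    \<open>y (T - 1)\<close>.\<close>
  have Y_out: "2 ^ n * (\<Sum>y\<in>Y. out y (y (T - 1))) \<le> real (card Y) * 1"
  proof -
    have "real (card ?X) * (\<Sum>y\<in>Y. out y (y (T - 1))) \<le> real (card Y) * 1"
      unfolding Y_def
    proof (rule sum_PiE_independent_le)
      show "out (y(T - 1 := v)) = out y" for y v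
        using indep[of "\<tau> n" "T - 1"] cJ by (simp add: out_def[abs_def] c_def J_def)
      fix y assume "y \<in> {..<T} \<rightarrow>\<^sub>E ?X"
      then show "(\<Sum>v\<in>?X. out y v) \<le> 1"
        unfolding out_def
        using sum_outcomes_le[OF machine unitary, of "?h y (\<tau> n)" a n] carrier nrm[of y "\<tau> n"]
        by (simp add: a Y_def)
    qed (use cJ in auto)
    then show ?thesis by (simp add: card_words)
  qed
  \<comment> \<open>\<open>mass y j\<close> depends on the chain values with index below
    \<open>c j\<close> only, so \<open>y l\<close> is a fresh word for it and receives on average at
    most a fraction \<open>1 / 2 ^ n\<close> of the unit mass.\<close>
  have Y_mass: "2 ^ n * (\<Sum>y\<in>Y. mass y j (y l)) \<le> real (card Y) * 1"
    if "j \<in> J" "l \<in> {c j..<T - 1}" for j l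
  proof -
    have "real (card ?X) * (\<Sum>y\<in>Y. mass y j (y l)) \<le> real (card Y) * 1"
      unfolding Y_def
    proof (rule sum_PiE_independent_le[where \<Phi> = "\<lambda>y. mass y j"])
      show "mass (y(l := v)) j = mass y j" for y v
        using indep[of j l] that by (simp add: mass_def[abs_def])
      fix y assume "y \<in> {..<T} \<rightarrow>\<^sub>E ?X"
      then show "(\<Sum>v\<in>?X. mass y j v) \<le> 1"
        unfolding mass_def
        using sum_query_mass_words[OF carrier[of y j]] nrm[of y j] that(1)
        by (simp add: Y_def J_def query_times_def)
    qed (use that in auto)
    then show ?thesis by (simp add: card_words)
  qed
  have "2 ^ n * (\<Sum>y\<in>Y. output_prob (reprogram a y f T) C \<tau> a (y (T - 1))) \<le>
    2 ^ n * (\<Sum>y\<in>Y. 2 * out y (y (T - 1)) +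
      8 * real (card J) * (\<Sum>j\<in>J. \<Sum>l\<in>{c j..<T - 1}. mass y j (y l)))"
    by (intro mult_left_mono sum_mono single) auto
  also have "(\<Sum>y\<in>Y. 2 * out y (y (T - 1)) +
      8 * real (card J) * (\<Sum>j\<in>J. \<Sum>l\<in>{c j..<T - 1}. mass y j (y l))) =
    2 * (\<Sum>y\<in>Y. out y (y (T - 1))) +
      8 * real (card J) * (\<Sum>j\<in>J. \<Sum>l\<in>{c j..<T - 1}. \<Sum>y\<in>Y. mass y j (y l))"
    by (simp only: sum.distrib sum_distrib_left[symmetric] sum.swap[of _ J Y] sum.swap[of _ _ Y])
  also have "2 ^ n * \<dots> = 2 * (2 ^ n * (\<Sum>y\<in>Y. out y (y (T - 1)))) +
      8 * real (card J) * (\<Sum>j\<in>J. \<Sum>l\<in>{c j..<T - 1}. 2 ^ n * (\<Sum>y\<in>Y. mass y j (y l)))"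
    by (simp add: sum_distrib_left[symmetric] distrib_left)
  also have "\<dots> \<le> 2 * (real (card Y) * 1) +
      8 * real (card J) * (\<Sum>j\<in>J. \<Sum>l\<in>{c j..<T - 1}. real (card Y) * 1)"
    using Y_out Y_mass by (intro add_mono mult_left_mono sum_mono) auto
  also have "\<dots> \<le> 2 * card Y + 8 * real T * (real T * (real T * card Y))"
  proof -
    have "(\<Sum>j\<in>J. \<Sum>l\<in>{c j..<T - 1}. real (card Y) * 1) \<le> (\<Sum>j\<in>J. real T * card Y)"
      by (intro sum_mono) (simp add: mult_right_mono)
    also have "\<dots> \<le> real T * (real T * card Y)"
      using cJ by (simp add: mult_right_mono)
    finally have "(\<Sum>j\<in>J. \<Sum>l\<in>{c j..<T - 1}. real (card Y) * 1) \<le> real T * (real T * card Y)" .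
    then show ?thesis using cJ
      by (intro add_mono mult_mono) (auto intro!: sum_nonneg)
  qed
  finally show ?thesis by (simp add: power3_eq_cube algebra_simps)
qed

subsection \<open>Counting the successful maps\<close>

lemma funpow_in_PiE: "f \<in> X \<rightarrow>\<^sub>E X \<Longrightarrow> x \<in> X \<Longrightarrow> (f ^^ k) x \<in> X"
  by (induction k) auto

text \<open>At the first collision of the orbit, redefining the map at the last point before the collision
  leaves the orbit up to that point unchanged.\<close>

lemma card_first_collision_le:
  fixes x :: 'a
  assumes X: "finite X" and x: "x \<in> X"
  shows "card {F \<in> X \<rightarrow>\<^sub>E X. inj_on (\<lambda>i. (F ^^ i) x) {..<j} \<and>
      (F ^^ j) x \<in> (\<lambda>i. (F ^^ i) x) ` {..<j}} * card X \<le> card (X \<rightarrow>\<^sub>E X) * j"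
proof (cases j)
  case (Suc k)
  let ?M = "X \<rightarrow>\<^sub>E X"
  let ?bad = "{F \<in> ?M. inj_on (\<lambda>i. (F ^^ i) x) {..<j} \<and> (F ^^ j) x \<in> (\<lambda>i. (F ^^ i) x) ` {..<j}}"
  \<comment> \<open>A decoding map: the \<open>k\<close>-th orbit point of the modified map carries
    the word \<open>h\<close>, and restoring the value given by the collision index \<open>i\<close>
    there returns \<open>F\<close>. Counting its image bounds the bad maps.\<close>
  let ?\<psi> = "\<lambda>(F, i). (F((F ^^ k) x := (F ^^ i) x), F ((F ^^ k) x))"
  have "?bad \<times> X \<subseteq> ?\<psi> ` (?M \<times> {..<j})"
  proof clarify
    fix F h i assume F: "F \<in> ?M" and inj: "inj_on (\<lambda>i. (F ^^ i) x) {..<j}" and h: "h \<in> X"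
      and i: "(F ^^ j) x = (F ^^ i) x" "i < j"
    define F' where "F' = F((F ^^ k) x := h)"
    \<comment> \<open>Injectivity keeps the earlier orbit points away from the modified one.\<close>
    have same: "(F' ^^ l) x = (F ^^ l) x" if "l \<le> k" for l
      using that
    proof (induction l)
      case (Suc l)
      have "(F ^^ l) x \<noteq> (F ^^ k) x"
        using inj_onD[OF inj, of l k] Suc.prems \<open>j = Suc k\<close> by auto
      then show ?case using Suc by (simp add: F'_def)
    qed simp
    have "F' \<in> insert ((F ^^ k) x) X \<rightarrow>\<^sub>E X"
      unfolding F'_def using F h by (intro PiE_fun_upd)
    then have "F' \<in> ?M" using funpow_in_PiE[OF F x, of k] by (simp only: insert_absorb)
    moreover have "?\<psi> (F', i) = (F, h)"
      using same[of i] same[of k] i Suc by (auto simp: F'_def)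
    ultimately show "(F, h) \<in> ?\<psi> ` (?M \<times> {..<j})"
      using i(2) by (intro image_eqI[of _ _ "(F', i)"]) auto
  qed
  then have "card (?bad \<times> X) \<le> card (?M \<times> {..<j})"
    using X by (intro surj_card_le) (auto intro: finite_PiE)
  then show ?thesis by (simp add: card_cartesian_product)
qed simp

text \<open>A sequence with a repetition has a first index \<open>j < T\<close> whose term occurred
  before; the union bound over \<open>j\<close> gives the square.\<close>

lemma card_orbit_collision_le:
  assumes X: "finite X" and x: "x \<in> X"
  shows "card {F \<in> X \<rightarrow>\<^sub>E X. \<not> inj_on (\<lambda>i. (F ^^ i) x) {..<T}} * card X \<le> card (X \<rightarrow>\<^sub>E X) * T\<^sup>2"
proof -
  let ?bad = "\<lambda>j. {F \<in> X \<rightarrow>\<^sub>E X. inj_on (\<lambda>i. (F ^^ i) x) {..<j} \<and>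
      (F ^^ j) x \<in> (\<lambda>i. (F ^^ i) x) ` {..<j}}"
  have fin: "finite (X \<rightarrow>\<^sub>E X)" using X by (simp add: finite_PiE)
  have "\<not> inj_on g {..<T} \<Longrightarrow> \<exists>j<T. inj_on g {..<j} \<and> g j \<in> g ` {..<j}" for g :: "nat \<Rightarrow> 'a"
  proof (induction T)
    case (Suc T)
    show ?case
    proof (cases "inj_on g {..<T}")
      case True
      with Suc.prems have "g T \<in> g ` {..<T}" by (simp add: lessThan_Suc)
      with True show ?thesis by blast
    next
      case False
      with Suc.IH show ?thesis by (meson less_SucI)
    qed
  qed simp
  then have "{F \<in> X \<rightarrow>\<^sub>E X. \<not> inj_on (\<lambda>i. (F ^^ i) x) {..<T}} \<subseteq> (\<Union>j<T. ?bad j)"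
    by blast
  then have "card {F \<in> X \<rightarrow>\<^sub>E X. \<not> inj_on (\<lambda>i. (F ^^ i) x) {..<T}} \<le> card (\<Union>j<T. ?bad j)"
    using fin by (intro card_mono) auto
  also have "\<dots> \<le> (\<Sum>j<T. card (?bad j))" by (rule card_UN_le) simp
  finally have "card {F \<in> X \<rightarrow>\<^sub>E X. \<not> inj_on (\<lambda>i. (F ^^ i) x) {..<T}} * card X \<le>
      (\<Sum>j<T. card (?bad j) * card X)"
    by (simp add: sum_distrib_right[symmetric])
  also have "\<dots> \<le> (\<Sum>j<T. card (X \<rightarrow>\<^sub>E X) * T)"
  proof (rule sum_mono)
    fix j assume "j \<in> {..<T}"
    then have "card (X \<rightarrow>\<^sub>E X) * j \<le> card (X \<rightarrow>\<^sub>E X) * T" by simp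
    with card_first_collision_le[OF assms, of j]
    show "card (?bad j) * card X \<le> card (X \<rightarrow>\<^sub>E X) * T" by linarith
  qed
  finally show ?thesis by (simp add: power2_eq_square mult_ac)
qed

text \<open>A counting form of the fact that reprogramming preserves uniformity. A map
  \<open>F\<close> with injective orbit and any words \<open>h\<close> come from a pair
  \<open>(f, y)\<close>: \<open>y\<close> follows the orbit of \<open>F\<close>, and
  \<open>f\<close> is \<open>F\<close> with its values on the orbit replaced by
  \<open>h\<close>.\<close>

lemma card_reprogram_le:
  fixes x :: 'a
  assumes X: "finite X" and x: "x \<in> X"
    and A: "A \<subseteq> X \<rightarrow>\<^sub>E X" and inj: "\<And>F. F \<in> A \<Longrightarrow> inj_on (\<lambda>i. (F ^^ i) x) {..<T}"
    and T: "T \<ge> 1"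
  shows "card A * card ({..<T} \<rightarrow>\<^sub>E X) \<le>
    card {(f, y) \<in> (X \<rightarrow>\<^sub>E X) \<times> ({..<T} \<rightarrow>\<^sub>E X).
      reprogram x y f T \<in> A \<and> y (T - 1) = (reprogram x y f T ^^ T) x}"
    (is "_ \<le> card ?B")
proof -
  let ?Y = "{..<T} \<rightarrow>\<^sub>E X"
  \<comment> \<open>The second component reads off the values of \<open>f\<close> that the chain
    overwrites.\<close>
  let ?\<psi> = "\<lambda>(f, y). (reprogram x y f T, \<lambda>i\<in>{..<T}. f (case_nat x y i))"
  have "A \<times> ?Y \<subseteq> ?\<psi> ` ?B"
  proof clarify
    fix F h assume F: "F \<in> A" and h: "h \<in> ?Y"
    let ?o = "\<lambda>i. (F ^^ i) x"
    have FM: "F \<in> X \<rightarrow>\<^sub>E X" using F A by blast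
    note orbit = funpow_in_PiE[OF FM x]
    define f where "f z = (if z \<in> ?o ` {..<T} then h (the_inv_into {..<T} ?o z) else F z)" for z
    define y where "y = (\<lambda>i\<in>{..<T}. ?o (Suc i))"
    have f_orbit: "f (?o i) = h i" if "i < T" for i
      using that the_inv_into_f_f[OF inj[OF F], of i] by (auto simp: f_def)
    have yY: "y \<in> ?Y" using orbit[of "Suc _"] by (auto simp: y_def)
    have chain: "case_nat x y i = ?o i" if "i < T" for i
      using that by (cases i) (auto simp: y_def)
    have fM: "f \<in> X \<rightarrow>\<^sub>E X"
    proof
      fix z assume "z \<in> X"
      show "f z \<in> X"
      proof (cases "z \<in> ?o ` {..<T}")
        case True
        then obtain i where "i < T" "z = ?o i" by auto
        then show ?thesis using f_orbit h by auto
      next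
        case False
        then show ?thesis using FM \<open>z \<in> X\<close> by (auto simp: f_def)
      qed
    next
      fix z assume "z \<notin> X"
      then have "z \<notin> ?o ` {..<T}" using orbit by auto
      then show "f z = undefined" using FM \<open>z \<notin> X\<close> by (auto simp: f_def)
    qed
    have "inj_on (case_nat x y) {..<T}"
      using inj[OF F] chain by (subst inj_on_cong[where g = ?o]) auto
    note at = reprogram_at[OF this, of _ f]
    have eq: "reprogram x y f T = F"
    proof
      fix z
      show "reprogram x y f T z = F z"
      proof (cases "z \<in> ?o ` {..<T}")
        case True
        then obtain i where i: "i < T" "z = ?o i" by auto
        then show ?thesis using at[of i] chain[of i] by (simp add: y_def)
      next
        case False
        then have "z \<notin> case_nat x y ` {0..<T}" using chain by auto
        then have "reprogram x y f T z = f z"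
          using reprogram_other[of z x y 0 T f] by simp
        then show ?thesis using False by (simp add: f_def)
      qed
    qed
    have "y (T - 1) = (F ^^ T) x" using T by (cases T) (simp_all add: y_def)
    then have "(f, y) \<in> ?B" using fM yY F by (simp add: eq)
    moreover have "?\<psi> (f, y) = (F, h)"
      using h f_orbit chain eq by (auto intro!: ext simp: PiE_def extensional_def)
    ultimately show "(F, h) \<in> ?\<psi> ` ?B" by (intro image_eqI[of _ _ "(f, y)"]) auto
  qed
  moreover have "finite ?B"
    using X by (intro finite_subset[of ?B "(X \<rightarrow>\<^sub>E X) \<times> ?Y"]) (auto intro: finite_PiE)
  ultimately have "card (A \<times> ?Y) \<le> card ?B" by (intro surj_card_le)
  then show ?thesis by (simp add: card_cartesian_product)
qed

lemma output_prob_nonneg: "output_prob f C \<tau> a w \<ge> 0"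
  unfolding output_prob_def Let_def by (intro sum_nonneg zero_le_power2)

text \<open>Markov's inequality with threshold \<open>2 / 3\<close> turns the averaged success
  probability into a count of the successful maps with injective orbit, giving
  \<open>3 + 12 T^3\<close>; maps with a colliding orbit contribute \<open>T^2\<close>.\<close>

lemma card_successful_maps_le:
  assumes machine: "query_machine \<U> C \<tau>" and unitary: "\<And>U. U \<in> \<U> \<Longrightarrow> unitary_mat U"
    and a: "length a = n" and evals: "evaluations C \<tau> a < T"
  shows "2 ^ n * real (card {F \<in> maps n. output_prob F C \<tau> a ((F ^^ T) a) \<ge> 2 / 3}) \<le>
    card (maps n) * (3 + 12 * real T ^ 3 + real T ^ 2)"
proof -
  let ?Y = "{..<T} \<rightarrow>\<^sub>E words n"
  let ?p = "\<lambda>f y. output_prob (reprogram a y f T) C \<tau> a (y (T - 1))"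
  define S where "S = {F \<in> maps n. output_prob F C \<tau> a ((F ^^ T) a) \<ge> 2 / 3}"
  define A where "A = {F \<in> S. inj_on (\<lambda>i. (F ^^ i) a) {..<T}}"
  define bad where "bad = {F \<in> maps n. \<not> inj_on (\<lambda>i. (F ^^ i) a) {..<T}}"
  define B where "B = {(f, y) \<in> maps n \<times> ?Y.
      reprogram a y f T \<in> A \<and> y (T - 1) = (reprogram a y f T ^^ T) a}"
  have aX: "a \<in> words n" using a by (simp add: words_def)
  have T: "T \<ge> 1" using evals by simp
  have Y: "card ?Y > 0" "finite ?Y"
    using card_words_pos[of n] by (simp_all add: card_PiE finite_PiE)
  have S: "F \<in> maps n" "output_prob F C \<tau> a ((F ^^ T) a) \<ge> 2 / 3" if "F \<in> S" for F
    using that by (simp_all add: S_def)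
  have A: "F \<in> S" "inj_on (\<lambda>i. (F ^^ i) a) {..<T}" if "F \<in> A" for F
    using that by (simp_all add: A_def)
  have B: "f \<in> maps n" "y \<in> ?Y" "2 / 3 \<le> ?p f y" if "(f, y) \<in> B" for f y
  proof -
    have "reprogram a y f T \<in> A" "y (T - 1) = (reprogram a y f T ^^ T) a"
      using that by (simp_all add: B_def)
    then show "2 / 3 \<le> ?p f y" using S(2) A(1) by simp
  qed (use that in \<open>simp_all add: B_def\<close>)
  have "card A * card ?Y \<le> card B"
    unfolding maps_def B_def by (rule card_reprogram_le) (use aX T A S in \<open>auto simp: maps_def\<close>)
  then have "real (card A) * card ?Y \<le> card B"
    by (simp only: of_nat_le_iff of_nat_mult[symmetric])
  then have "2 / 3 * (real (card A) * card ?Y) \<le> (\<Sum>p\<in>B. 2 / 3)" by simp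
  also have "\<dots> \<le> (\<Sum>(f, y)\<in>B. ?p f y)"
    by (rule sum_mono) (use B in auto)
  also have "\<dots> \<le> (\<Sum>(f, y)\<in>maps n \<times> ?Y. ?p f y)"
  proof (rule sum_mono2)
    show "B \<subseteq> maps n \<times> ?Y" unfolding B_def by blast
  qed (use Y in \<open>simp_all add: split_beta output_prob_nonneg\<close>)
  also have "\<dots> = (\<Sum>f\<in>maps n. \<Sum>y\<in>?Y. ?p f y)"
    by (simp add: sum.cartesian_product)
  finally have "2 ^ n * (2 / 3 * (real (card A) * card ?Y)) \<le>
      2 ^ n * (\<Sum>f\<in>maps n. \<Sum>y\<in>?Y. ?p f y)"
    by (rule mult_left_mono) simp
  also have "\<dots> = (\<Sum>f\<in>maps n. 2 ^ n * (\<Sum>y\<in>?Y. ?p f y))"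
    by (rule sum_distrib_left)
  also have "\<dots> \<le> card (maps n) * (card ?Y * (2 + 8 * real T ^ 3))"
    by (rule sum_bounded_above) (rule sum_output_prob_reprogram_le[OF machine unitary a evals])
  finally have "(2 ^ n * real (card A) * 2) * real (card ?Y) \<le>
      (3 * real (card (maps n)) * (2 + 8 * real T ^ 3)) * real (card ?Y)"
    by (simp add: algebra_simps)
  then have "2 ^ n * real (card A) * 2 \<le> 3 * real (card (maps n)) * (2 + 8 * real T ^ 3)"
    by (rule mult_right_le_imp_le) (use Y(1) in simp)
  then have good: "2 ^ n * real (card A) \<le> card (maps n) * (3 + 12 * real T ^ 3)"
    by (simp add: algebra_simps)
  have "card bad * card (words n) \<le> card (maps n) * T\<^sup>2"
    unfolding maps_def bad_def by (rule card_orbit_collision_le[OF finite_words aX])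
  then have "real (card bad * card (words n)) \<le> real (card (maps n) * T\<^sup>2)"
    by (simp only: of_nat_le_iff)
  then have bad: "2 ^ n * real (card bad) \<le> card (maps n) * real T ^ 2"
    by (simp add: card_words mult.commute)
  have "finite A" "finite bad"
    using S(1) A(1) by (auto simp: bad_def intro: finite_subset[OF _ finite_maps])
  moreover have "S \<subseteq> A \<union> bad"
    using S(1) by (auto simp: A_def bad_def)
  ultimately have "card S \<le> card A + card bad"
    by (meson card_Un_le card_mono finite_UnI order_trans)
  then have "2 ^ n * real (card S) \<le> 2 ^ n * (real (card A) + card bad)" by simp
  also have "\<dots> \<le> card (maps n) * (3 + 12 * real T ^ 3 + real T ^ 2)"
    using good bad by (simp add: distrib_left)
  finally show ?thesis unfolding S_def .
qed

subsection \<open>Almost all oracles\<close>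

lemma length_oracle: "f \<in> oracles \<Longrightarrow> length (f x) = length x"
  by (simp add: oracles_def)

lemma restrict_in_maps: "f \<in> oracles \<Longrightarrow> restrict f (words n) \<in> maps n"
  by (auto simp: maps_def words_def length_oracle)

lemma hybrid_state_oracle_cong:
  assumes "\<And>b. length b = length a \<Longrightarrow> f b = g b"
  shows "hybrid_state (\<lambda>_. f) C \<tau> a i = hybrid_state (\<lambda>_. g) C \<tau> a i"
proof (induction i)
  case (Suc i)
  have "query_basis f t (length a) (bits (t + 2 * length a) j) =
      query_basis g t (length a) (bits (t + 2 * length a) j)" for t j
    by (simp add: query_basis_def Let_def assms)
  then have "query_transform f t (length a) = query_transform g t (length a)" for t
    by (simp add: query_transform_def)
  then show ?case using Suc by (simp add: step_matrix_def Let_def)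
qed simp

text \<open>On an input of length \<open>n\<close> the oracle is consulted at words of length
  \<open>n\<close> only, so success there is an event about a single restriction.\<close>

lemma output_prob_restrict:
  assumes "length a = n"
  shows "output_prob (restrict f (words n)) C \<tau> a w = output_prob f C \<tau> a w"
proof -
  have "quantum_state (restrict f (words n)) C \<tau> a i = quantum_state f C \<tau> a i" for i
    unfolding quantum_state_eq_hybrid_state
    by (rule hybrid_state_oracle_cong) (simp add: words_def assms)
  then show ?thesis by (simp only: output_prob_def)
qed

lemma funpow_restrict:
  assumes "f \<in> oracles" "length a = n"
  shows "(restrict f (words n) ^^ k) a = (f ^^ k) a"
proof (induction k)
  case (Suc k)
  have "length ((f ^^ k) a) = n"
    using assms by (induction k) (simp_all add: length_oracle)
  then show ?case using Suc by (simp add: words_def)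
qed simp

definition oracle_event :: "nat \<Rightarrow> (bool list \<Rightarrow> bool list) set \<Rightarrow> (bool list \<Rightarrow> bool list) set" where
  "oracle_event n S = {f \<in> oracles. restrict f (words n) \<in> S}"

text \<open>A cylinder fixes all restrictions up to length \<open>n\<close>; letting those below
  \<open>n\<close> range over all maps gives a finite union of cylinders.\<close>

lemma sets_oracle_event:
  assumes "n \<ge> 1"
  shows "oracle_event n S \<in> sets oracle_measure"
proof -
  let ?G = "{g \<in> PiE {1..n} maps. g n \<in> S}"
  have "oracle_event n S = (\<Union>g\<in>?G. cylinder n g)"
  proof (intro equalityI subsetI)
    fix f assume f: "f \<in> oracle_event n S"
    let ?g = "\<lambda>i\<in>{1..n}. restrict f (words i)"
    have "?g \<in> ?G" "f \<in> cylinder n ?g"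
      using f assms by (auto simp: oracle_event_def cylinder_def restrict_in_maps simp del: restrict_apply)
        (auto simp: restrict_in_maps)
    then show "f \<in> (\<Union>g\<in>?G. cylinder n g)" by blast
  qed (use assms in \<open>auto simp: oracle_event_def cylinder_def\<close>)
  moreover have "cylinder n g \<in> sets oracle_measure" if "g \<in> ?G" for g
    using that unfolding sets_oracle_measure
    by (intro sigma_sets.Basic) (auto simp: cylinders_def)
  moreover have "finite ?G"
    by (rule finite_subset[of _ "PiE {1..n} maps"]) (auto intro: finite_PiE)
  ultimately show ?thesis by (metis (no_types, lifting) sets.finite_UN)
qed

text \<open>Pulled back to the product space, the event constrains coordinate \<open>n\<close>
  alone, which is uniform.\<close>

lemma measure_oracle_event:
  assumes n: "n \<ge> 1" and S: "S \<subseteq> maps n"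
  shows "measure oracle_measure (oracle_event n S) = card S / card (maps n)"
proof -
  let ?M = "\<lambda>n. uniform_count_measure (maps n)"
  have "oracle_of -` oracle_event n S \<inter> space (PiM {1..} ?M) =
      prod_emb {1..} ?M {n} (PiE {n} (\<lambda>_. S))"
  proof -
    have "h \<in> oracle_of -` oracle_event n S \<longleftrightarrow> h n \<in> S" if "h \<in> PiE {1..} maps" for h
    proof -
      have h: "\<And>i. i \<ge> 1 \<Longrightarrow> h i \<in> maps i" using that by auto
      show ?thesis
        using oracle_of_in_oracles[of h, OF h] restrict_oracle_of[of h n, OF h n]
        by (simp add: oracle_event_def)
    qed
    then show ?thesis
      by (auto simp: prod_emb_def space_PiM space_uniform_count_measure restrict_PiE_iff)
  qed
  then have "emeasure oracle_measure (oracle_event n S) =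
      emeasure (PiM {1..} ?M) (prod_emb {1..} ?M {n} (PiE {n} (\<lambda>_. S)))"
    using sets_oracle_event[OF n, of S] unfolding oracle_measure_def
    by (subst emeasure_distr[OF measurable_oracle_of]) (simp_all add: oracle_measure_def)
  also have "\<dots> = (\<Prod>i\<in>{n}. emeasure (?M i) S)"
    using n S by (intro emeasure_PiM_emb prob_space_maps) (auto simp: sets_uniform_count_measure)
  also have "\<dots> = ennreal (card S / card (maps n))"
    using S by (simp add: emeasure_uniform_count_measure)
  finally show ?thesis by (simp add: measure_def)
qed

text \<open>Success on all inputs implies success on one input of each length. The measurable
  superset \<open>N\<close> of the successful oracles thus has measure below every term, from length
  1 on, of a null sequence.\<close>

lemma AE_not_computes:
  assumes machine: "query_machine \<U> C \<tau>" and unitary: "\<And>U. U \<in> \<U> \<Longrightarrow> unitary_mat U"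
    and evals: "\<And>x. evaluations C \<tau> x < T (length x)"
    and lim: "(\<lambda>n. (3 + 12 * real (T n) ^ 3 + real (T n) ^ 2) / 2 ^ n) \<longlonglongrightarrow> 0"
  shows "AE f in oracle_measure. \<not> computes f C \<tau> (\<lambda>x. (f ^^ T (length x)) x)"
proof -
  interpret prob_space oracle_measure by (rule prob_space_oracle_measure)
  \<comment> \<open>One test word per length; the counting bound holds for any choice of it.\<close>
  define a where "a n = replicate n False" for n
  have a: "length (a n) = n" for n by (simp add: a_def)
  define S where "S n = {F \<in> maps n. output_prob F C \<tau> (a n) ((F ^^ T n) (a n)) \<ge> 2 / 3}" for n
  define N where "N = (\<Inter>n\<in>{1..}. oracle_event n (S n))"
  let ?b = "\<lambda>n. (3 + 12 * real (T n) ^ 3 + real (T n) ^ 2) / 2 ^ n"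
  have N_sets: "N \<in> sets oracle_measure"
    unfolding N_def by (intro sets.countable_INT') (auto intro: sets_oracle_event)
  have "measure oracle_measure N \<le> ?b n" if n: "n \<ge> 1" for n
  proof -
    have "2 ^ n * real (card (S n)) \<le> card (maps n) * (3 + 12 * real (T n) ^ 3 + real (T n) ^ 2)"
      unfolding S_def
      by (rule card_successful_maps_le[OF machine unitary a]) (use evals[of "a n"] a in auto)
    then have *: "card (S n) / card (maps n) \<le> ?b n"
      by (simp add: card_maps field_simps)
    have "measure oracle_measure N \<le> measure oracle_measure (oracle_event n (S n))"
      using n by (intro finite_measure_mono sets_oracle_event) (auto simp: N_def)
    also have "\<dots> = card (S n) / card (maps n)"
      using n by (intro measure_oracle_event) (auto simp: S_def)
    finally show ?thesis using * by simp
  qed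
  then have "\<exists>n0. \<forall>n\<ge>n0. measure oracle_measure N \<le> ?b n" by blast
  then have "measure oracle_measure N \<le> 0"
    by (rule LIMSEQ_le_const[OF lim])
  then have "measure oracle_measure N = 0" by (simp add: measure_le_0_iff)
  then have "N \<in> null_sets oracle_measure"
    using N_sets by (simp add: null_sets_def emeasure_eq_measure)
  moreover have "f \<in> N" if "f \<in> oracles" "computes f C \<tau> (\<lambda>x. (f ^^ T (length x)) x)" for f
  proof -
    have "restrict f (words n) \<in> S n" for n
    proof -
      have "output_prob f C \<tau> (a n) ((f ^^ T (length (a n))) (a n)) \<ge> 2 / 3"
        using that(2) unfolding computes_def by blast
      then show ?thesis
        using that(1) a[of n] by (simp only: S_def mem_Collect_eq restrict_in_maps output_prob_restrict funpow_restrict simp_thms)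
    qed
    then show ?thesis using that(1) by (simp add: N_def oracle_event_def)
  qed
  ultimately show ?thesis
    by (intro AE_I'[of N]) (auto simp: space_oracle_measure)
qed

section \<open>Countability of machines\<close>

instance tape :: countable
  by countable_datatype

instance move :: countable
  by countable_datatype

instance letter :: countable
  by countable_datatype

instance head_state :: countable
  by countable_datatype

lemma countable_UNIV_tm: "countable (UNIV :: tm set)"
proof -
  have "M \<in> (\<lambda>(h, l). \<lparr>heads = h, table = fmap_of_list l\<rparr>) ` UNIV" for M :: tm
  proof -
    obtain l where "table M = fmap_of_list l"
      by (metis fmap_of_list_surj surj_def)
    then have "M = (\<lambda>(h, l). \<lparr>heads = h, table = fmap_of_list l\<rparr>) (heads M, l)" by simp
    then show ?thesis by blast
  qed
  then have "UNIV \<subseteq> range (\<lambda>(h, l). \<lparr>heads = h, table = fmap_of_list l\<rparr>)" by blast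
  then show ?thesis by (rule countable_subset) (rule countable_image, rule countableI_type)
qed

text \<open>Only the gate attached to \<^const>\<open>q_w\<close> is ever applied, so up to equivalence there are only
  countably many machines although the gate assignments form an uncountable set.\<close>

definition const_gate :: "machine \<Rightarrow> machine" where
  "const_gate C = C\<lparr>gate := \<lambda>_. gate C q_w\<rparr>"

lemma classical_state_const_gate [simp]: "classical_state (const_gate C) = classical_state C"
  by (simp add: classical_state_def[abs_def] const_gate_def)

lemma query_machine_const_gate: "query_machine \<U> C \<tau> \<Longrightarrow> query_machine \<U> (const_gate C) \<tau>"
  unfolding query_machine_def classical_state_const_gate Let_def
  by (simp add: const_gate_def)

lemma evaluations_const_gate: "evaluations (const_gate C) = evaluations C"
  by (simp add: evaluations_def[abs_def])

lemma quantum_state_const_gate: "quantum_state f (const_gate C) \<tau> a i = quantum_state f C \<tau> a i"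
  by (induction i) (simp_all add: Let_def, simp add: const_gate_def)

lemma computes_const_gate: "computes f (const_gate C) \<tau> F = computes f C \<tau> F"
proof -
  have "readout (const_gate C) = readout C" by (simp add: const_gate_def)
  then show ?thesis
    by (simp only: computes_def output_prob_def quantum_state_const_gate classical_state_const_gate)
qed

lemma countable_const_gate:
  assumes "finite \<U>"
  shows "countable (const_gate ` {C. \<forall>q. gate C q \<in> \<U>})"
proof -
  let ?h = "\<lambda>(M, R, U). \<lparr>classical = M, gate = \<lambda>_. U, readout = R\<rparr>"
  have "const_gate C = ?h (classical C, readout C, gate C q_w)" for C
    by (simp add: const_gate_def)
  then have "const_gate ` {C. \<forall>q. gate C q \<in> \<U>} \<subseteq> ?h ` (UNIV \<times> UNIV \<times> \<U>)" by blast
  moreover have "countable (?h ` (UNIV \<times> UNIV \<times> \<U>))"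
    using assms countable_UNIV_tm
    by (intro countable_image countable_SIGMA) (auto intro: countable_finite)
  ultimately show ?thesis by (rule countable_subset)
qed

text \<open>The running time is the moment of the first arrival at \<open>q_o\<close>. Uniqueness
  removes the uncountable choice of \<open>\<tau>\<close> from the union of null sets.\<close>

lemma query_machine_time_unique:
  assumes "query_machine \<U> C \<tau>" "query_machine \<U> C \<tau>'"
  shows "\<tau> = \<tau>'"
proof
  fix n
  have *: "\<tau> n = \<tau>' n" if "query_machine \<U> C \<tau>" "query_machine \<U> C \<tau>'" "\<tau> n \<le> \<tau>' n" for \<tau> \<tau>'
  proof -
    have "control (classical_state C a i) = q_o \<longleftrightarrow> i = \<tau> (length a)" if "i \<le> \<tau> (length a)" for a i
      using \<open>query_machine \<U> C \<tau>\<close> that unfolding query_machine_def Let_def by blast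
    from this[of "\<tau> n" "replicate n False"]
    have "control (classical_state C (replicate n False) (\<tau> n)) = q_o" by simp
    moreover have "control (classical_state C a i) = q_o \<longleftrightarrow> i = \<tau>' (length a)"
      if "i \<le> \<tau>' (length a)" for a i
      using \<open>query_machine \<U> C \<tau>'\<close> that unfolding query_machine_def Let_def by blast
    from this[of "\<tau> n" "replicate n False"] that(3)
    have "control (classical_state C (replicate n False) (\<tau> n)) = q_o \<longleftrightarrow> \<tau> n = \<tau>' n" by simp
    ultimately show ?thesis by simp
  qed
  show "\<tau> n = \<tau>' n"
    using *[OF assms] *[OF assms(2,1)] by (cases "\<tau> n \<le> \<tau>' n") auto
qed

text \<open>As \<open>T n \<ge> 1\<close>, the numerator is at most \<open>16 (T n)^3\<close>.
  Cubing the growth bound and dividing by \<open>2 ^ n\<close> leaves a geometric sequence with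
  ratio \<open>2 powr (3 / (7 + \<epsilon>) - 1) < 1\<close>.\<close>

lemma bound_tendsto_0:
  fixes T :: "nat \<Rightarrow> nat"
  assumes \<epsilon>: "\<epsilon> > 0" and T: "\<And>n. T n \<ge> 1"
    and O: "(\<lambda>n. real (T n)) \<in> O(\<lambda>n. 2 powr (real n / (7 + \<epsilon>)))"
  shows "(\<lambda>n. (3 + 12 * real (T n) ^ 3 + real (T n) ^ 2) / 2 ^ n) \<longlonglongrightarrow> 0"
proof -
  obtain c where c: "eventually (\<lambda>n. norm (real (T n)) \<le> c * norm (2 powr (real n / (7 + \<epsilon>)))) sequentially"
    using O by (rule landau_o.bigE)
  define q where "q = (2::real) powr (3 / (7 + \<epsilon>) - 1)"
  have "q < 1" using \<epsilon> by (simp add: q_def powr_less_one field_simps)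
  then have "(\<lambda>n. 16 * c ^ 3 * q ^ n) \<longlonglongrightarrow> 0"
    by (intro tendsto_mult_right_zero LIMSEQ_power_zero) (simp add: q_def)
  then show ?thesis
  proof (rule Lim_null_comparison[rotated])
    show "eventually (\<lambda>n. norm ((3 + 12 * real (T n) ^ 3 + real (T n) ^ 2) / 2 ^ n) \<le> 16 * c ^ 3 * q ^ n) sequentially"
      using c
    proof eventually_elim
      case (elim n)
      have t: "real (T n) \<ge> 1" using T[of n] by simp
      have "real (T n) ^ 3 \<le> (c * 2 powr (real n / (7 + \<epsilon>))) ^ 3"
        using elim by (intro power_mono) auto
      also have "\<dots> = c ^ 3 * (2 powr (3 * real n / (7 + \<epsilon>)))"
        by (simp add: power_mult_distrib powr_power)
      also have "2 powr (3 * real n / (7 + \<epsilon>)) = q ^ n * 2 ^ n"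
      proof -
        have "q ^ n * 2 ^ n = 2 powr ((3 / (7 + \<epsilon>) - 1) * real n) * 2 powr real n"
          by (simp add: q_def powr_power powr_realpow mult.commute)
        also have "\<dots> = 2 powr ((3 / (7 + \<epsilon>) - 1) * real n + real n)"
          by (rule powr_add[symmetric])
        also have "(3 / (7 + \<epsilon>) - 1) * real n + real n = 3 * real n / (7 + \<epsilon>)"
          by (simp add: algebra_simps)
        finally show ?thesis by simp
      qed
      finally have cube: "real (T n) ^ 3 \<le> c ^ 3 * (q ^ n * 2 ^ n)" .
      have "real (T n) ^ 2 \<le> real (T n) ^ 3" "1 \<le> real (T n) ^ 3"
        using t by (auto intro: power_increasing)
      then have "3 + 12 * real (T n) ^ 3 + real (T n) ^ 2 \<le> 16 * (c ^ 3 * (q ^ n * 2 ^ n))"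
        using cube by linarith
      then show ?case by (simp add: field_simps)
    qed
  qed
qed

theorem theorem1:
  fixes \<epsilon> :: real and T :: "nat \<Rightarrow> nat" and \<U> :: "complex mat set"
  assumes "\<epsilon> > 0"
    and "\<And>n. T n \<ge> 1"
    and "(\<lambda>n. real (T n)) \<in> O(\<lambda>n. 2 powr (real n / (7 + \<epsilon>)))"
    and "finite \<U>"
    and "\<And>U. U \<in> \<U> \<Longrightarrow> unitary_mat U \<and> (\<exists>m. dim_row U = 2 ^ m)"
  shows "AE f in oracle_measure.
    \<not> (\<exists>C \<tau>. query_machine \<U> C \<tau> \<and>
          computes f C \<tau> (\<lambda>x. (f ^^ T (length x)) x) \<and>
          (\<forall>x. evaluations C \<tau> x \<le> T (length x) - 1))"
proof -
  let ?K = "const_gate ` {C. \<forall>q. gate C q \<in> \<U>}"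
  let ?fast = "\<lambda>f C \<tau>. query_machine \<U> C \<tau> \<and> computes f C \<tau> (\<lambda>x. (f ^^ T (length x)) x) \<and>
          (\<forall>x. evaluations C \<tau> x \<le> T (length x) - 1)"
  have lim: "(\<lambda>n. (3 + 12 * real (T n) ^ 3 + real (T n) ^ 2) / 2 ^ n) \<longlonglongrightarrow> 0"
    by (rule bound_tendsto_0) (rule assms)+
  have "AE f in oracle_measure. \<forall>\<tau>. \<not> ?fast f C \<tau>" for C
  proof (cases "\<exists>\<tau>. query_machine \<U> C \<tau> \<and> (\<forall>x. evaluations C \<tau> x \<le> T (length x) - 1)")
    case True
    then obtain \<tau> where \<tau>: "query_machine \<U> C \<tau>" "\<And>x. evaluations C \<tau> x \<le> T (length x) - 1" by blast
    have "evaluations C \<tau> x < T (length x)" for x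
      using \<tau>(2)[of x] assms(2)[of "length x"] by linarith
    then have "AE f in oracle_measure. \<not> computes f C \<tau> (\<lambda>x. (f ^^ T (length x)) x)"
      using AE_not_computes[OF \<tau>(1) _ _ lim] assms(5) by blast
    then show ?thesis
      \<comment> \<open>Any other time function of \<open>C\<close> equals the chosen
        \<open>\<tau>\<close>.\<close>
      by eventually_elim (use query_machine_time_unique[OF \<tau>(1)] in blast)
  next
    case False
    then show ?thesis by (intro AE_I2) blast
  qed
  \<comment> \<open>Only representatives with a constant gate are quantified over, so the
    exceptional sets form a countable family.\<close>
  then have "AE f in oracle_measure. \<forall>C\<in>?K. \<forall>\<tau>. \<not> ?fast f C \<tau>"
    using assms(4) by (subst AE_ball_countable) (auto intro: countable_const_gate)
  then show ?thesis
  proof eventually_elim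
    case (elim f)
    show ?case
    proof clarify
      fix C \<tau> assume *: "query_machine \<U> C \<tau>" "computes f C \<tau> (\<lambda>x. (f ^^ T (length x)) x)"
        "\<forall>x. evaluations C \<tau> x \<le> T (length x) - 1"
      \<comment> \<open>An arbitrary fast machine is traded for its representative, which computes
        the same words with the same number of evaluations.\<close>
      have "const_gate C \<in> ?K" using *(1) by (auto simp: query_machine_def)
      moreover have "?fast f (const_gate C) \<tau>"
        using * query_machine_const_gate by (simp add: computes_const_gate evaluations_const_gate)
      ultimately show False using elim by blast
    qed
  qed
qed

end
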